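(* Consider the over-the-air average consensus protocol described in the context, with step sizes $\alpha(k)>0$ satisfying (i) $\sum_{k=0}^\infty \alpha(k)=\infty$ and $\sum_{k=0}^\infty \alpha^2(k)<\infty$, and (ii) $1-\alpha(k)\sum_{j\in\mathcal{V}}\bar a_{ij}>0$ for all $i\in\mathcal{V}$, $k\ge 0$. Then $$\lim_{k\to\infty}\mathbb{E}\big[\Vert (I_N-J)\boldsymbol{x}(k)\Vert^2\big]=0,\qquad J=\tfrac1N\mathbf{1}_N\mathbf{1}_N^T,$$ i.e. the system achieves weak consensus: $\lim_{k\to\infty}\mathbb{E}\big[(x_i(k)-\tfrac1N\mathbf{1}_N^T\boldsymbol{x}(k))^2\big]=0$ for all $i$.
   Context: Agents $\mathcal{V}=\{1,\dots,N\}$ communicate over a connected undirected graph $\mathcal{G}=(\mathcal{V},\mathcal{E})$ without self-loops; $\widetilde{\mathcal{N}}_i=\{j:(i,j)\in\mathcal{E}\}$. Each agent has a deterministic initial state $x_i(0)\in[0,x_{\max}]$; $\boldsymbol{x}(k)=(x_1(k),\dots,x_N(k))^T$. Fix $\rho>0$ and $u\in\mathbb{C}$ with $|u|=1$. The following random variables are all mutually independent: for each $i$ and $k\ge0$, $\gamma_i(k)\in\{0,1\}$ with $\mathbb{P}(\gamma_i(k)=1)=p_i\in(0,1)$ (agent $i$ transmits in slot 1 if $\gamma_i(k)=1$, slot 2 otherwise, and receives in the other slot); for each ordered pair $(i,j)$ and $k\ge0$, $h_{ij}(k)\sim\mathcal{CN}(0,\Lambda_{ij})$ with $\Lambda_{ij}=\Lambda_{ji}>0$;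 for each $i$ and $k\ge0$, $n_i(k)\sim\mathcal{CN}(0,\sigma_i^2)$. Let $\Gamma_{ij}(k)=\gamma_i(k)(1-\gamma_j(k))+\gamma_j(k)(1-\gamma_i(k))$. Agent $i$ receives $y_i(k)=\sum_{j\in\widetilde{\mathcal{N}}_i}\Gamma_{ij}(k)h_{ij}(k)\sqrt{\rho x_j(k)}\,u+n_i(k)$ (the model treats the states as nonnegative so that the square root is real). Define $\bar a_{ij}=\rho\big(p_i(1-p_j)+p_j(1-p_i)\big)\Lambda_{ij}$ for $j\in\widetilde{\mathcal{N}}_i$ and $\bar a_{ij}=0$ otherwise. The protocol is $$x_i(k+1)=\Big(1-\alpha(k)\sum_{j\in\mathcal{V}}\bar a_{ij}\Big)x_i(k)+\alpha(k)\big(|y_i(k)|^2-\sigma_i^2\big).$$ *)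

theory Defs
  imports "HOL-Probability.Probability"
begin

text \<open>Index type for the family of all primitive random variables of the model:
  the slot choices gamma_i(k), the channel gains h_ij(k), and the noises n_i(k).\<close>
datatype src = Gam nat nat | Chan nat nat nat | Noise nat nat

text \<open>Circularly-symmetric complex Gaussian CN(0,v), v > 0: density
  1/(pi v) exp(-|z|^2/v) w.r.t. Lebesgue measure on the complex plane.\<close>
definition complex_normal :: "'a measure \<Rightarrow> ('a \<Rightarrow> complex) \<Rightarrow> real \<Rightarrow> bool" where
  "complex_normal M Z v \<longleftrightarrow>
     distributed M lborel Z (\<lambda>z. ennreal (exp (- (cmod z)\<^sup>2 / v) / (pi * v)))"

text \<open>Undirected connected graph on agents {0..<N} with symmetric irreflexive adjacency E.\<close>
definition undirected_graph :: "nat \<Rightarrow> (nat \<Rightarrow> nat \<Rightarrow> bool) \<Rightarrow> bool" where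
  "undirected_graph N E \<longleftrightarrow>
     (\<forall>i j. E i j \<longrightarrow> i < N \<and> j < N \<and> i \<noteq> j \<and> E j i)"

definition connected_graph :: "nat \<Rightarrow> (nat \<Rightarrow> nat \<Rightarrow> bool) \<Rightarrow> bool" where
  "connected_graph N E \<longleftrightarrow> (\<forall>i<N. \<forall>j<N. (E\<^sup>*\<^sup>*) i j)"

text \<open>Expected weights bar a_ij.\<close>
definition abar :: "(nat \<Rightarrow> nat \<Rightarrow> bool) \<Rightarrow> real \<Rightarrow> (nat \<Rightarrow> real) \<Rightarrow> (nat \<Rightarrow> nat \<Rightarrow> real)
                    \<Rightarrow> nat \<Rightarrow> nat \<Rightarrow> real" where
  "abar E \<rho> p \<Lambda> i j =
     (if E i j then \<rho> * (p i * (1 - p j) + p j * (1 - p i)) * \<Lambda> i j else 0)"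

end

theory Submission
  imports Defs
begin

text \<open>Nothing keeps the states nonnegative. For negative arguments the library function is
  \<open>sqrt (-t) = - sqrt t\<close>, so the received power only sees \<open>\<bar>x\<^sub>j\<bar>\<close> and the mean dynamics is
  \<open>f\<^sub>i(x) = \<Sum>\<^sub>j a\<^sub>i\<^sub>j (\<bar>x\<^sub>j\<bar> - x\<^sub>i)\<close> instead of linear consensus. The quantity \<open>W(x) = - x \<cdot> f(x)\<close>
  is still nonnegative, vanishes only at nonnegative consensus states, and dominates both \<open>\<bar>f(x)\<bar>\<^sup>2\<close>
  and the disagreement \<open>V(x)\<close>, the latter by connectedness. Writing
  \<open>x(k+1) = x(k) + \<alpha>(k) (f(x(k)) + D(k))\<close>, the noise \<open>D(k)\<close> is uncorrelated with the past and has
  second moment at most \<open>K (1 + E\<bar>x(k)\<bar>\<^sup>2)\<close>. Hence \<open>E\<bar>x(k)\<bar>\<^sup>2\<close> is bounded,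
  \<open>\<Sum> \<alpha>(k) E W(x(k)) < \<infinity>\<close>, and \<open>E V(x(k))\<close> increases only by summable amounts; it therefore
  converges, and its limit is 0 because \<open>\<Sum> \<alpha>(k) = \<infinity>\<close>.\<close>

section \<open>The deterministic drift\<close>

definition drift :: "nat \<Rightarrow> (nat \<Rightarrow> nat \<Rightarrow> real) \<Rightarrow> (nat \<Rightarrow> real) \<Rightarrow> nat \<Rightarrow> real" where
  "drift N a x i = (\<Sum>j<N. a i j * (\<bar>x j\<bar> - x i))"

text \<open>Minus half the rate of change of the squared norm along the flow x' = f(x).\<close>

definition dissip :: "nat \<Rightarrow> (nat \<Rightarrow> nat \<Rightarrow> real) \<Rightarrow> (nat \<Rightarrow> real) \<Rightarrow> real" where
  "dissip N a x = - (\<Sum>i<N. x i * drift N a x i)"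

locale sym_weights =
  fixes N :: nat and a :: "nat \<Rightarrow> nat \<Rightarrow> real"
  assumes sym: "\<And>i j. i < N \<Longrightarrow> j < N \<Longrightarrow> a i j = a j i"
    and nonneg: "\<And>i j. i < N \<Longrightarrow> j < N \<Longrightarrow> 0 \<le> a i j"
begin

text \<open>With \<open>z = \<bar>x\<bar>\<close> and \<open>m = z - x\<close> one has \<open>x\<^sup>2 = z\<^sup>2\<close>, which makes the first part a Laplacian form in \<open>z\<close>.\<close>
lemma dissip_eq:
  "2 * dissip N a x =
     (\<Sum>i<N. \<Sum>j<N. a i j * (\<bar>x i\<bar> - \<bar>x j\<bar>)\<^sup>2 + 2 * (a i j * ((\<bar>x i\<bar> - x i) * \<bar>x j\<bar>)))"
proof -
  \<comment> \<open>By symmetry of the weights half of the diagonal term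
    \<open>a i j * (x i)\<^sup>2\<close> may be charged to \<open>j\<close>; this is what completes
    the square \<open>(\<bar>x i\<bar> - \<bar>x j\<bar>)\<^sup>2\<close> below.\<close>
  have swap: "(\<Sum>i<N. \<Sum>j<N. a i j * (x i)\<^sup>2) = (\<Sum>i<N. \<Sum>j<N. a i j * (x j)\<^sup>2)"
    by (subst sum.swap) (auto intro!: sum.cong simp: sym)
  have "2 * dissip N a x = (\<Sum>i<N. \<Sum>j<N. 2 * (a i j * (x i)\<^sup>2) - 2 * (a i j * (x i * \<bar>x j\<bar>)))"
    unfolding dissip_def drift_def sum_distrib_left sum_negf[symmetric]
    by (intro sum.cong refl) (simp add: algebra_simps power2_eq_square)
  also have "\<dots> = (\<Sum>i<N. \<Sum>j<N. a i j * (x i)\<^sup>2) + (\<Sum>i<N. \<Sum>j<N. a i j * (x j)\<^sup>2)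
      - (\<Sum>i<N. \<Sum>j<N. 2 * (a i j * (x i * \<bar>x j\<bar>)))"
    by (simp add: sum_subtractf swap flip: sum_distrib_left)
  also have "\<dots> = (\<Sum>i<N. \<Sum>j<N. a i j * (\<bar>x i\<bar> - \<bar>x j\<bar>)\<^sup>2 + 2 * (a i j * ((\<bar>x i\<bar> - x i) * \<bar>x j\<bar>)))"
    unfolding sum.distrib[symmetric] sum_subtractf[symmetric]
    by (intro sum.cong refl) (simp add: power2_diff algebra_simps)
  finally show ?thesis .
qed

text \<open>Each summand of \<open>dissip_eq\<close> consists of two nonnegative terms, and dropping
  the cross term gives the first bound. The second bound needs both: a negative \<open>x i\<close>
  is paid for by the cross term if \<open>\<bar>x j\<bar>\<close> is large, and by the gap between
  \<open>\<bar>x i\<bar>\<close> and \<open>\<bar>x j\<bar>\<close> if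
  \<open>\<bar>x j\<bar>\<close> is small.\<close>

lemma dissip_ge:
  "(\<Sum>i<N. \<Sum>j<N. a i j * (\<bar>x i\<bar> - \<bar>x j\<bar>)\<^sup>2) \<le> 2 * dissip N a x"
  "(\<Sum>i<N. \<Sum>j<N. a i j * (\<bar>x i\<bar> - x i)\<^sup>2) \<le> 8 * dissip N a x"
proof -
  have pos: "0 \<le> a i j * ((\<bar>x i\<bar> - x i) * \<bar>x j\<bar>)" if "i < N" "j < N" for i j
    using nonneg[OF that] by (intro mult_nonneg_nonneg) auto
  show "(\<Sum>i<N. \<Sum>j<N. a i j * (\<bar>x i\<bar> - \<bar>x j\<bar>)\<^sup>2) \<le> 2 * dissip N a x"
    unfolding dissip_eq by (intro sum_mono) (use pos in auto)
  have "a i j * (\<bar>x i\<bar> - x i)\<^sup>2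
      \<le> 4 * (a i j * (\<bar>x i\<bar> - \<bar>x j\<bar>)\<^sup>2 + 2 * (a i j * ((\<bar>x i\<bar> - x i) * \<bar>x j\<bar>)))"
    if "i < N" "j < N" for i j
  proof -
    define z w m where "z = \<bar>x i\<bar>" and "w = \<bar>x j\<bar>" and "m = z - x i"
    \<comment> \<open>\<open>m\<close> is \<open>0\<close> or \<open>2 * z\<close> according to the
      sign of \<open>x i\<close>. Inserting this into the expansion of
      \<open>(m - 2 * (z - w))\<^sup>2\<close> yields
      \<open>m\<^sup>2 \<le> 4 * (z - w)\<^sup>2 + 4 * (m * w)\<close>. The last coefficient is
      raised to 8 so that the bound becomes four times a summand of \<open>dissip_eq\<close> once
      weighted.\<close>
    have "m\<^sup>2 = 2 * (m * z)"
      unfolding m_def z_def by (auto simp: abs_if power2_eq_square algebra_simps)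
    moreover have "0 \<le> m\<^sup>2 - 4 * (m * z) + 4 * (m * w) + 4 * (z - w)\<^sup>2"
      using zero_le_power2[of "m - 2 * (z - w)"] by (simp add: power2_eq_square algebra_simps)
    moreover have "0 \<le> m * w" by (auto simp: m_def z_def w_def)
    ultimately have "m\<^sup>2 \<le> 4 * (z - w)\<^sup>2 + 8 * (m * w)" by linarith
    hence "a i j * m\<^sup>2 \<le> a i j * (4 * (z - w)\<^sup>2 + 8 * (m * w))"
      by (intro mult_left_mono nonneg that)
    thus ?thesis by (simp add: z_def w_def m_def algebra_simps)
  qed
  hence "(\<Sum>i<N. \<Sum>j<N. a i j * (\<bar>x i\<bar> - x i)\<^sup>2)
     \<le> (\<Sum>i<N. \<Sum>j<N. 4 * (a i j * (\<bar>x i\<bar> - \<bar>x j\<bar>)\<^sup>2 + 2 * (a i j * ((\<bar>x i\<bar> - x i) * \<bar>x j\<bar>))))"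
    by (intro sum_mono) auto
  also have "\<dots> = 4 * (2 * dissip N a x)"
    by (simp only: dissip_eq sum_distrib_left)
  also have "\<dots> = 8 * dissip N a x" by simp
  finally show "(\<Sum>i<N. \<Sum>j<N. a i j * (\<bar>x i\<bar> - x i)\<^sup>2) \<le> 8 * dissip N a x" .
qed

lemma dissip_nonneg: "0 \<le> dissip N a x"
proof -
  have "0 \<le> (\<Sum>i<N. \<Sum>j<N. a i j * (\<bar>x i\<bar> - \<bar>x j\<bar>)\<^sup>2)"
    by (intro sum_nonneg mult_nonneg_nonneg nonneg) auto
  with dissip_ge(1)[of x] show ?thesis by linarith
qed

text \<open>Cauchy-Schwarz with weights \<open>a i j\<close> bounds the squared drift by squares of
  \<open>\<bar>x j\<bar> - x i\<close>. That difference is \<open>\<bar>x i\<bar> - x i\<close>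
  minus \<open>\<bar>x i\<bar> - \<bar>x j\<bar>\<close>, and \<open>dissip_ge\<close> controls both
  parts.\<close>

lemma drift_sq_le_dissip:
  "\<exists>C\<ge>0. \<forall>x. (\<Sum>i<N. (drift N a x i)\<^sup>2) \<le> C * dissip N a x"
proof -
  define S where "S = (\<Sum>i<N. \<Sum>j<N. a i j)"
  have S0: "S \<ge> 0" unfolding S_def by (intro sum_nonneg) (auto intro: nonneg)
  \<comment> \<open>The total weight \<open>S\<close> bounds every row sum. The factor is 20 = 2 * 2
    + 2 * 8: each square is doubled when the difference is split, and \<open>dissip_ge\<close>
    contributes 2 and 8.\<close>
  have "(\<Sum>i<N. (drift N a x i)\<^sup>2) \<le> (20 * S) * dissip N a x" for x
  proof -
    have "(drift N a x i)\<^sup>2 \<le> S * (\<Sum>j<N. 2 * (a i j * (\<bar>x i\<bar> - \<bar>x j\<bar>)\<^sup>2) + 2 * (a i j * (\<bar>x i\<bar> - x i)\<^sup>2))"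
      if i: "i < N" for i
    proof -
      have "drift N a x i = (\<Sum>j<N. sqrt (a i j) * (sqrt (a i j) * (\<bar>x j\<bar> - x i)))"
        unfolding drift_def
        by (intro sum.cong refl) (use nonneg i in \<open>simp flip: mult.assoc\<close>)
      hence "(drift N a x i)\<^sup>2 \<le> (\<Sum>j<N. (sqrt (a i j))\<^sup>2) * (\<Sum>j<N. (sqrt (a i j) * (\<bar>x j\<bar> - x i))\<^sup>2)"
        using Cauchy_Schwarz_ineq_sum by metis
      also have "\<dots> = (\<Sum>j<N. a i j) * (\<Sum>j<N. a i j * (\<bar>x j\<bar> - x i)\<^sup>2)"
        by (intro arg_cong2[of _ _ _ _ "(*)"] sum.cong refl) (use nonneg i in \<open>auto simp: power_mult_distrib\<close>)
      also have "\<dots> \<le> S * (\<Sum>j<N. 2 * (a i j * (\<bar>x i\<bar> - \<bar>x j\<bar>)\<^sup>2) + 2 * (a i j * (\<bar>x i\<bar> - x i)\<^sup>2))"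
      proof (intro mult_mono sum_mono S0)
        show "(\<Sum>j<N. a i j) \<le> S" unfolding S_def
          by (rule member_le_sum) (use i in \<open>auto intro!: sum_nonneg nonneg\<close>)
        show "a i j * (\<bar>x j\<bar> - x i)\<^sup>2 \<le> 2 * (a i j * (\<bar>x i\<bar> - \<bar>x j\<bar>)\<^sup>2) + 2 * (a i j * (\<bar>x i\<bar> - x i)\<^sup>2)"
          if "j \<in> {..<N}" for j
        proof -
          have "(q - p)\<^sup>2 \<le> 2 * p\<^sup>2 + 2 * q\<^sup>2" for p q :: real
            using zero_le_power2[of "p + q"] by (simp add: power2_eq_square algebra_simps)
          from this[of "\<bar>x i\<bar> - x i" "\<bar>x i\<bar> - \<bar>x j\<bar>"]
          have "(\<bar>x j\<bar> - x i)\<^sup>2 \<le> 2 * (\<bar>x i\<bar> - \<bar>x j\<bar>)\<^sup>2 + 2 * (\<bar>x i\<bar> - x i)\<^sup>2"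
            by simp
          hence "a i j * (\<bar>x j\<bar> - x i)\<^sup>2 \<le> a i j * (2 * (\<bar>x i\<bar> - \<bar>x j\<bar>)\<^sup>2 + 2 * (\<bar>x i\<bar> - x i)\<^sup>2)"
            using that i by (intro mult_left_mono nonneg) auto
          thus ?thesis by (simp add: algebra_simps)
        qed
        show "0 \<le> (\<Sum>j<N. a i j * (\<bar>x j\<bar> - x i)\<^sup>2)"
          using i by (intro sum_nonneg mult_nonneg_nonneg nonneg) auto
      qed
      finally show ?thesis .
    qed
    hence "(\<Sum>i<N. (drift N a x i)\<^sup>2)
      \<le> (\<Sum>i<N. S * (\<Sum>j<N. 2 * (a i j * (\<bar>x i\<bar> - \<bar>x j\<bar>)\<^sup>2) + 2 * (a i j * (\<bar>x i\<bar> - x i)\<^sup>2)))"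
      by (intro sum_mono) auto
    also have "\<dots> = S * (2 * (\<Sum>i<N. \<Sum>j<N. a i j * (\<bar>x i\<bar> - \<bar>x j\<bar>)\<^sup>2)
        + 2 * (\<Sum>i<N. \<Sum>j<N. a i j * (\<bar>x i\<bar> - x i)\<^sup>2))"
      by (simp add: sum.distrib flip: sum_distrib_left)
    also have "\<dots> \<le> S * (20 * dissip N a x)"
      using dissip_ge[of x] S0 by (intro mult_left_mono) auto
    finally show ?thesis by (simp add: mult_ac)
  qed
  with S0 show ?thesis by (intro exI[of _ "20 * S"]) auto
qed

text \<open>Going from \<open>x i\<close> to \<open>x j\<close> through
  \<open>\<bar>x i\<bar>\<close> and \<open>\<bar>x j\<bar>\<close> gives three increments, whose
  weighted squares are at most 8, 2 and 8 times the dissipation. Squaring a sum of three terms costs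
  a factor 3, so the constant is 3 * (8 + 2 + 8) = 54.\<close>

lemma edge_diff_le_dissip:
  assumes ij: "i < N" "j < N" and aij: "a i j > 0"
  shows "(x i - x j)\<^sup>2 \<le> (54 / a i j) * dissip N a x"
proof -
  have single: "a k l * g k l \<le> (\<Sum>i<N. \<Sum>j<N. a i j * g i j)"
    if "k < N" "l < N" "\<And>i j. 0 \<le> g i j" for k l and g :: "nat \<Rightarrow> nat \<Rightarrow> real"
  proof -
    have "a k l * g k l \<le> (\<Sum>j<N. a k j * g k j)"
      by (rule member_le_sum) (use that nonneg in auto)
    also have "\<dots> \<le> (\<Sum>i<N. \<Sum>j<N. a i j * g i j)"
      by (rule member_le_sum[of k "{..<N}" "\<lambda>i. \<Sum>j<N. a i j * g i j"])
        (use that nonneg in \<open>auto intro!: sum_nonneg mult_nonneg_nonneg\<close>)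
    finally show ?thesis .
  qed
  define W where "W = dissip N a x"
  have 1: "a i j * (\<bar>x i\<bar> - \<bar>x j\<bar>)\<^sup>2 \<le> 2 * W"
    using single[of i j "\<lambda>i j. (\<bar>x i\<bar> - \<bar>x j\<bar>)\<^sup>2"] dissip_ge(1)[of x] ij by (simp add: W_def)
  have 2: "a i j * (\<bar>x i\<bar> - x i)\<^sup>2 \<le> 8 * W"
    using single[of i j "\<lambda>i j. (\<bar>x i\<bar> - x i)\<^sup>2"] dissip_ge(2)[of x] ij by (simp add: W_def)
  have 3: "a i j * (\<bar>x j\<bar> - x j)\<^sup>2 \<le> 8 * W"
    using single[of j i "\<lambda>i j. (\<bar>x i\<bar> - x i)\<^sup>2"] dissip_ge(2)[of x] ij sym[of i j] by (simp add: W_def)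
  have sq3: "(p - q + r)\<^sup>2 \<le> 3 * p\<^sup>2 + 3 * q\<^sup>2 + 3 * r\<^sup>2" for p q r :: real
  proof -
    have "0 \<le> (p + q)\<^sup>2 + (p - r)\<^sup>2 + (q + r)\<^sup>2" by simp
    thus ?thesis by (simp add: power2_eq_square algebra_simps)
  qed
  have "a i j * (x i - x j)\<^sup>2
      = a i j * ((\<bar>x i\<bar> - \<bar>x j\<bar>) - (\<bar>x i\<bar> - x i) + (\<bar>x j\<bar> - x j))\<^sup>2" by simp
  also have "\<dots> \<le> a i j * (3 * (\<bar>x i\<bar> - \<bar>x j\<bar>)\<^sup>2 + 3 * (\<bar>x i\<bar> - x i)\<^sup>2 + 3 * (\<bar>x j\<bar> - x j)\<^sup>2)"
    using aij by (intro mult_left_mono sq3) auto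
  also have "\<dots> \<le> 54 * W" using 1 2 3 by (simp add: algebra_simps)
  finally show ?thesis using aij by (simp add: W_def field_simps)
qed

text \<open>This is where connectedness enters: edge bounds are chained along a path by induction,
  so every difference \<open>x i - x j\<close> is controlled. The deviation of \<open>x i\<close>
  from the mean is the average over \<open>j\<close> of these differences.\<close>

lemma disagreement_le_dissip:
  assumes E: "\<And>i j. E i j \<Longrightarrow> i < N \<and> j < N \<and> a i j > 0"
    and conn: "\<And>i j. i < N \<Longrightarrow> j < N \<Longrightarrow> E\<^sup>*\<^sup>* i j"
  shows "\<exists>C\<ge>0. \<forall>x. (\<Sum>i<N. (x i - (\<Sum>j<N. x j) / real N)\<^sup>2) \<le> C * dissip N a x"
proof -
  have path: "\<exists>C\<ge>0. \<forall>x. (x i - x j)\<^sup>2 \<le> C * dissip N a x" if "E\<^sup>*\<^sup>* i j" for i j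
    using that
  proof induction
    case base
    show ?case by (rule exI[of _ 0]) simp
  next
    case (step j l)
    then obtain C where C: "C \<ge> 0" "\<And>x. (x i - x j)\<^sup>2 \<le> C * dissip N a x" by blast
    note e = E[OF step.hyps(2)]
    have "(x i - x l)\<^sup>2 \<le> (2 * C + 2 * (54 / a j l)) * dissip N a x" for x
    proof -
      have "0 \<le> ((x i - x j) - (x j - x l))\<^sup>2" by simp
      hence "(x i - x l)\<^sup>2 \<le> 2 * (x i - x j)\<^sup>2 + 2 * (x j - x l)\<^sup>2"
        by (simp add: power2_eq_square algebra_simps)
      also have "\<dots> \<le> 2 * (C * dissip N a x) + 2 * ((54 / a j l) * dissip N a x)"
        using C(2)[of x] edge_diff_le_dissip[of j l x] e by linarith
      finally show ?thesis by (simp add: algebra_simps)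
    qed
    moreover have "0 \<le> 2 * C + 2 * (54 / a j l)" using C e by auto
    ultimately show ?case by blast
  qed
  obtain C where C: "\<And>i j. i < N \<Longrightarrow> j < N \<Longrightarrow> C i j \<ge> 0"
     "\<And>i j x. i < N \<Longrightarrow> j < N \<Longrightarrow> (x i - x j)\<^sup>2 \<le> C i j * dissip N a x"
    using path[OF conn] by metis
  have "(\<Sum>i<N. (x i - (\<Sum>j<N. x j) / real N)\<^sup>2) \<le> (\<Sum>i<N. \<Sum>j<N. C i j) * dissip N a x" for x
  proof -
    have "(x i - (\<Sum>j<N. x j) / real N)\<^sup>2 \<le> (\<Sum>j<N. C i j) * dissip N a x" if i: "i < N" for i
    proof -
      have "x i - (\<Sum>j<N. x j) / real N = (\<Sum>j<N. x i - x j) / real N"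
        using i by (simp add: sum_subtractf field_simps)
      hence "(x i - (\<Sum>j<N. x j) / real N)\<^sup>2 = (\<Sum>j<N. x i - x j)\<^sup>2 / (real N)\<^sup>2"
        by (simp add: power_divide)
      also have "\<dots> \<le> (real N * (\<Sum>j<N. (x i - x j)\<^sup>2)) / (real N)\<^sup>2"
        using sum_squared_le_sum_of_squares[of "\<lambda>j. x i - x j" "{..<N}"] i
        by (intro divide_right_mono) (auto simp: mult.commute)
      also have "\<dots> = (\<Sum>j<N. (x i - x j)\<^sup>2) / real N" using i by (simp add: power2_eq_square)
      also have "\<dots> \<le> (\<Sum>j<N. (x i - x j)\<^sup>2) / 1"
        using i by (intro divide_left_mono sum_nonneg) auto
      also have "\<dots> \<le> (\<Sum>j<N. C i j * dissip N a x)"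
        unfolding div_by_1 by (intro sum_mono C i) auto
      finally show ?thesis by (simp add: sum_distrib_right)
    qed
    hence "(\<Sum>i<N. (x i - (\<Sum>j<N. x j) / real N)\<^sup>2) \<le> (\<Sum>i<N. (\<Sum>j<N. C i j) * dissip N a x)"
      by (intro sum_mono) auto
    thus ?thesis by (simp add: sum_distrib_right)
  qed
  moreover have "0 \<le> (\<Sum>i<N. \<Sum>j<N. C i j)" by (intro sum_nonneg C) auto
  ultimately show ?thesis by blast
qed

end

section \<open>Almost decreasing sequences\<close>

text \<open>Subtracting the partial sums of \<open>b\<close> from \<open>v\<close> leaves a
  decreasing sequence bounded below, hence \<open>v\<close> converges. If its limit \<open>l\<close>
  were positive, then eventually \<alpha> would be at most \<open>2 / l\<close> times the summable
  sequence \<alpha> v, contradicting divergence.\<close>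

lemma almost_decreasing_tendsto_0:
  fixes v b \<alpha> :: "nat \<Rightarrow> real"
  assumes v0: "\<And>k. 0 \<le> v k" and step: "\<And>k. v (Suc k) \<le> v k + b k" and b: "summable b"
    and \<alpha>0: "\<And>k. 0 \<le> \<alpha> k" and \<alpha>: "\<not> summable \<alpha>" and av: "summable (\<lambda>k. \<alpha> k * v k)"
  shows "v \<longlonglongrightarrow> 0"
proof -
  define w where "w k = v k - (\<Sum>j<k. b j)" for k
  have B: "(\<lambda>k. \<Sum>j<k. b j) \<longlonglongrightarrow> suminf b" using b by (rule summable_LIMSEQ)
  have "decseq w" by (rule decseq_SucI) (use step in \<open>simp add: w_def algebra_simps\<close>)
  moreover obtain K where K: "\<And>k. (\<Sum>j<k. b j) \<le> K"
    using B[THEN convergentI, THEN convergent_imp_Bseq, THEN BseqD] by (metis abs_le_D1 real_norm_def)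
  hence "\<And>k. - K \<le> w k" using v0 unfolding w_def by (smt (verit))
  ultimately obtain L where "w \<longlonglongrightarrow> L" by (metis decseq_convergent)
  hence "(\<lambda>k. w k + (\<Sum>j<k. b j)) \<longlonglongrightarrow> L + suminf b" by (intro tendsto_add B)
  hence v: "v \<longlonglongrightarrow> L + suminf b" by (simp add: w_def)
  have "L + suminf b \<ge> 0" using v v0 by (intro LIMSEQ_le_const) auto
  moreover have "\<not> L + suminf b > 0"
  proof
    assume pos: "L + suminf b > 0"
    define l where "l = L + suminf b"
    have "eventually (\<lambda>k. v k > l / 2) sequentially"
      using v pos by (intro order_tendstoD) (auto simp: l_def)
    then obtain K0 where K0: "\<And>k. k \<ge> K0 \<Longrightarrow> v k > l / 2" by (auto simp: eventually_sequentially)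
    have "summable \<alpha>"
    proof (rule summable_comparison_test')
      show "summable (\<lambda>k. (2 / l) * (\<alpha> k * v k))" by (intro summable_mult av)
      show "norm (\<alpha> k) \<le> (2 / l) * (\<alpha> k * v k)" if "k \<ge> K0" for k
      proof -
        have "\<alpha> k * (l / 2) \<le> \<alpha> k * v k" using K0[OF that] \<alpha>0 by (intro mult_left_mono) auto
        thus ?thesis using \<alpha>0[of k] pos by (simp add: l_def field_simps)
      qed
    qed
    with \<alpha> show False by simp
  qed
  ultimately show ?thesis using v by simp
qed

text \<open>Discrete Gronwall: since 1 + c \<le> exp c, the product of the growth factors stays
  below the exponential of the total sum of \<open>c\<close>.\<close>

lemma gronwall_bounded:
  fixes T c :: "nat \<Rightarrow> real"
  assumes c: "summable c" "\<And>k. 0 \<le> c k" and T: "\<And>k. 0 \<le> T k" "\<And>k. T (Suc k) \<le> (1 + c k) * T k"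
  shows "\<exists>B. \<forall>k. T k \<le> B"
proof -
  have "T k \<le> exp (\<Sum>j<k. c j) * T 0" for k
  proof (induction k)
    case (Suc k)
    have "T (Suc k) \<le> (1 + c k) * T k" by (rule T)
    also have "\<dots> \<le> exp (c k) * (exp (\<Sum>j<k. c j) * T 0)"
      using c T Suc by (intro mult_mono) (auto intro: exp_ge_add_one_self)
    finally show ?case by (simp add: exp_add mult_ac)
  qed simp
  moreover have "exp (\<Sum>j<k. c j) * T 0 \<le> exp (suminf c) * T 0" for k
    using c T sum_le_suminf[of c "{..<k}"] by (intro mult_right_mono) auto
  ultimately show ?thesis by (meson order_trans)
qed

section \<open>Mean-square convergence from uncorrelated noise\<close>

text \<open>The mean minimises the sum of squared deviations. With \<open>c\<close> taken as the
  previous mean, this makes it unnecessary to follow how the mean itself moves during a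
  step.\<close>

lemma sum_sq_average_le:
  fixes x :: "nat \<Rightarrow> real"
  shows "(\<Sum>i<N. (x i - (\<Sum>j<N. x j) / real N)\<^sup>2) \<le> (\<Sum>i<N. (x i - c)\<^sup>2)"
proof -
  define m where "m = (\<Sum>j<N. x j) / real N"
  have "(\<Sum>i<N. (x i - c)\<^sup>2) = (\<Sum>i<N. (x i - m)\<^sup>2 + (2 * (m - c) * (x i - m) + (m - c)\<^sup>2))"
    by (intro sum.cong refl) (simp add: power2_eq_square algebra_simps)
  also have "\<dots> = (\<Sum>i<N. (x i - m)\<^sup>2) + (2 * (m - c) * (\<Sum>i<N. x i - m) + real N * (m - c)\<^sup>2)"
    by (simp add: sum.distrib flip: sum_distrib_left)
  also have "(\<Sum>i<N. x i - m) = 0" by (cases "N = 0") (auto simp: sum_subtractf m_def)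
  finally show ?thesis unfolding m_def by simp
qed

text \<open>Measurability is a separate conjunct because integrability of the square yields
  measurability of the square only.\<close>

definition L2 :: "'a measure \<Rightarrow> ('a \<Rightarrow> real) \<Rightarrow> bool" where
  "L2 M X \<longleftrightarrow> X \<in> borel_measurable M \<and> integrable M (\<lambda>\<omega>. (X \<omega>)\<^sup>2)"

lemma L2_measurable: "L2 M X \<Longrightarrow> X \<in> borel_measurable M"
  and L2_square: "L2 M X \<Longrightarrow> integrable M (\<lambda>\<omega>. (X \<omega>)\<^sup>2)"
  by (auto simp: L2_def)

lemma L2_bound:
  assumes X: "L2 M X" and Y: "Y \<in> borel_measurable M" and le: "\<And>\<omega>. \<omega> \<in> space M \<Longrightarrow> \<bar>Y \<omega>\<bar> \<le> \<bar>X \<omega>\<bar>"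
  shows "L2 M Y"
  unfolding L2_def
proof
  show "integrable M (\<lambda>\<omega>. (Y \<omega>)\<^sup>2)"
    by (rule Bochner_Integration.integrable_bound[OF L2_square[OF X]])
      (use Y le in \<open>auto intro!: AE_I2 simp: abs_le_square_iff\<close>)
qed (rule Y)

lemma L2_mult:
  assumes X: "L2 M X" and Y: "L2 M Y"
  shows "integrable M (\<lambda>\<omega>. X \<omega> * Y \<omega>)"
proof (rule Bochner_Integration.integrable_bound)
  show "integrable M (\<lambda>\<omega>. (X \<omega>)\<^sup>2 + (Y \<omega>)\<^sup>2)" using X Y by (auto simp: L2_def)
  have "\<bar>s * t\<bar> \<le> s\<^sup>2 + t\<^sup>2" for s t :: real
  proof -
    have "2 * \<bar>s * t\<bar> \<le> s\<^sup>2 + t\<^sup>2"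
      using zero_le_power2[of "\<bar>s\<bar> - \<bar>t\<bar>"] by (simp add: power2_diff abs_mult)
    thus ?thesis using abs_ge_zero[of "s * t"] by linarith
  qed
  thus "AE \<omega> in M. norm (X \<omega> * Y \<omega>) \<le> norm ((X \<omega>)\<^sup>2 + (Y \<omega>)\<^sup>2)" by simp
qed (use X Y in \<open>auto simp: L2_def\<close>)

lemma L2_add: assumes X: "L2 M X" and Y: "L2 M Y" shows "L2 M (\<lambda>\<omega>. X \<omega> + Y \<omega>)"
  using L2_mult[OF X Y] X Y by (auto simp: L2_def power2_sum mult.assoc)

lemma L2_cmult: "L2 M X \<Longrightarrow> L2 M (\<lambda>\<omega>. c * X \<omega>)"
  by (auto simp: L2_def power_mult_distrib)

lemma L2_diff: "L2 M X \<Longrightarrow> L2 M Y \<Longrightarrow> L2 M (\<lambda>\<omega>. X \<omega> - Y \<omega>)"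
  using L2_add[of M X "\<lambda>\<omega>. (-1) * Y \<omega>"] L2_cmult[of M Y "-1"] by simp

lemma L2_zero: "L2 M (\<lambda>_. 0)" by (simp add: L2_def)

lemma L2_sum: "(\<And>i. i \<in> I \<Longrightarrow> L2 M (X i)) \<Longrightarrow> L2 M (\<lambda>\<omega>. \<Sum>i\<in>I. X i \<omega>)"
  by (induction I rule: infinite_finite_induct) (auto intro: L2_add L2_zero)

lemma L2_abs: "L2 M X \<Longrightarrow> L2 M (\<lambda>\<omega>. \<bar>X \<omega>\<bar>)"
  by (auto simp: L2_def)

lemma (in prob_space) L2_const: "L2 M (\<lambda>_. c)" by (simp add: L2_def)

lemma (in prob_space) L2_integrable: "L2 M X \<Longrightarrow> integrable M X"
  using L2_mult[of M X "\<lambda>_. 1"] L2_const[of 1] by simp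

lemma L2_drift:
  "(\<And>j. j < N \<Longrightarrow> L2 M (x j)) \<Longrightarrow> i < N \<Longrightarrow> L2 M (\<lambda>\<omega>. drift N a (\<lambda>j. x j \<omega>) i)"
  unfolding drift_def by (intro L2_sum L2_cmult L2_diff L2_abs) auto

text \<open>The channel model is abstracted away: the noise enters only through its second moments
  and its orthogonality to the current states. Its second moment may grow with that of the state, so
  boundedness of the states has to be derived here.\<close>

lemma (in prob_space) mean_square_consensus:
  fixes x D :: "nat \<Rightarrow> nat \<Rightarrow> 'a \<Rightarrow> real" and \<alpha> :: "nat \<Rightarrow> real"
  assumes W: "sym_weights N a"
    and E: "\<And>i j. E i j \<Longrightarrow> i < N \<and> j < N \<and> a i j > 0"
    and conn: "\<And>i j. i < N \<Longrightarrow> j < N \<Longrightarrow> E\<^sup>*\<^sup>* i j"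
    and x: "\<And>k i. i < N \<Longrightarrow> L2 M (x k i)" and D: "\<And>k i. i < N \<Longrightarrow> L2 M (D k i)"
    and step: "\<And>k i \<omega>. i < N \<Longrightarrow> \<omega> \<in> space M \<Longrightarrow>
       x (Suc k) i \<omega> = x k i \<omega> + \<alpha> k * (drift N a (\<lambda>j. x k j \<omega>) i + D k i \<omega>)"
    and orth: "\<And>k i l. i < N \<Longrightarrow> l < N \<Longrightarrow> expectation (\<lambda>\<omega>. x k l \<omega> * D k i \<omega>) = 0"
    and K: "K \<ge> 0" "\<And>k i. i < N \<Longrightarrow>
       expectation (\<lambda>\<omega>. (D k i \<omega>)\<^sup>2) \<le> K * (1 + (\<Sum>j<N. expectation (\<lambda>\<omega>. (x k j \<omega>)\<^sup>2)))"
    and \<alpha>: "\<And>k. 0 \<le> \<alpha> k" "\<not> summable \<alpha>" "summable (\<lambda>k. (\<alpha> k)\<^sup>2)"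
  shows "(\<lambda>k. expectation (\<lambda>\<omega>. \<Sum>i<N. (x k i \<omega> - (\<Sum>j<N. x k j \<omega>) / real N)\<^sup>2)) \<longlonglongrightarrow> 0"
proof -
  interpret sym_weights N a by (rule W)
  define f where "f k i \<omega> = drift N a (\<lambda>j. x k j \<omega>) i" for k i \<omega>
  define y where "y k i \<omega> = x k i \<omega> - (\<Sum>j<N. x k j \<omega>) / real N" for k i \<omega>
  define w where "w k \<omega> = dissip N a (\<lambda>j. x k j \<omega>)" for k \<omega>
  \<comment> \<open>The summand 1 turns the noise bound into \<open>K * T k\<close>, which makes the
    growth estimate homogeneous in \<open>T\<close>.\<close>
  define T where "T k = 1 + (\<Sum>j<N. expectation (\<lambda>\<omega>. (x k j \<omega>)\<^sup>2))" for k
  have f: "L2 M (f k i)" if "i < N" for k i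
    unfolding f_def by (intro L2_drift x that)
  have y: "L2 M (y k i)" if "i < N" for k i
    unfolding y_def using L2_cmult[OF L2_sum[of "{..<N}" M "x k"], of "1 / real N"]
    by (auto intro!: L2_diff x that)
  have w_eq: "w k \<omega> = - (\<Sum>i<N. x k i \<omega> * f k i \<omega>)" for k \<omega>
    by (simp add: w_def dissip_def f_def)
  have w: "integrable M (w k)" for k
    unfolding w_eq by (auto intro!: L2_mult x f)
  have w0: "0 \<le> expectation (w k)" for k
    by (intro Bochner_Integration.integral_nonneg) (simp add: w_def dissip_nonneg)
  obtain C1 where C1: "C1 \<ge> 0" and C1': "\<forall>x. (\<Sum>i<N. (drift N a x i)\<^sup>2) \<le> C1 * dissip N a x"
    using drift_sq_le_dissip by blast
  have C1: "C1 \<ge> 0" "(\<Sum>i<N. (f k i \<omega>)\<^sup>2) \<le> C1 * w k \<omega>" for k \<omega>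
    unfolding f_def w_def using C1 C1' by auto
  obtain C2 where C2: "C2 \<ge> 0"
    and C2': "\<forall>x. (\<Sum>i<N. (x i - (\<Sum>j<N. x j) / real N)\<^sup>2) \<le> C2 * dissip N a x"
    using disagreement_le_dissip[OF E conn] by blast
  have C2: "C2 \<ge> 0" "(\<Sum>i<N. (y k i \<omega>)\<^sup>2) \<le> C2 * w k \<omega>" for k \<omega>
    unfolding y_def w_def using C2 C2' by auto
  \<comment> \<open>A self-bounding argument: |f|^2 \<le> C1 w = - C1 x.f, while - 2 C1 x.f \<le>
    C1^2 |x|^2 + |f|^2. Twice the first inequality combined with the second lets one |f|^2 be
    absorbed on the left.\<close>
  have f_le: "(\<Sum>i<N. (f k i \<omega>)\<^sup>2) \<le> C1\<^sup>2 * (\<Sum>i<N. (x k i \<omega>)\<^sup>2)" for k \<omega>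
  proof -
    have "2 * (C1 * w k \<omega>) = (\<Sum>i<N. - 2 * (C1 * (x k i \<omega> * f k i \<omega>)))"
      by (simp add: w_eq sum_distrib_left sum_negf)
    also have "\<dots> \<le> (\<Sum>i<N. C1\<^sup>2 * (x k i \<omega>)\<^sup>2 + (f k i \<omega>)\<^sup>2)"
    proof (rule sum_mono)
      fix i
      have "0 \<le> (C1 * x k i \<omega> + f k i \<omega>)\<^sup>2" by simp
      thus "- 2 * (C1 * (x k i \<omega> * f k i \<omega>)) \<le> C1\<^sup>2 * (x k i \<omega>)\<^sup>2 + (f k i \<omega>)\<^sup>2"
        by (simp add: power2_sum power_mult_distrib)
    qed
    also have "\<dots> = C1\<^sup>2 * (\<Sum>i<N. (x k i \<omega>)\<^sup>2) + (\<Sum>i<N. (f k i \<omega>)\<^sup>2)"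
      by (simp add: sum.distrib sum_distrib_left)
    finally show ?thesis using C1(2)[of k \<omega>] by linarith
  qed
  \<comment> \<open>From (f + D)^2 \<le> 2 f^2 + 2 D^2: the drift contributes
    \<open>C1\<^sup>2\<close> by \<open>f_le\<close>, and each of the \<open>N\<close> noise
    coordinates contributes \<open>K\<close>.\<close>
  define G where "G = 2 * C1\<^sup>2 + 2 * (real N * K)"
  have G0: "G \<ge> 0" using K by (simp add: G_def)
  have T1: "T k \<ge> 1" for k by (auto simp: T_def intro!: sum_nonneg)
  have g: "L2 M (\<lambda>\<omega>. f k i \<omega> + D k i \<omega>)" if "i < N" for k i by (intro L2_add f D that)
  have G: "(\<Sum>i<N. expectation (\<lambda>\<omega>. (f k i \<omega> + D k i \<omega>)\<^sup>2)) \<le> G * T k" for k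
  proof -
    have "(\<Sum>i<N. expectation (\<lambda>\<omega>. (f k i \<omega> + D k i \<omega>)\<^sup>2))
        \<le> (\<Sum>i<N. expectation (\<lambda>\<omega>. 2 * (f k i \<omega>)\<^sup>2 + 2 * (D k i \<omega>)\<^sup>2))"
    proof (intro sum_mono integral_mono)
      fix i \<omega>
      have "0 \<le> (f k i \<omega> - D k i \<omega>)\<^sup>2" by simp
      thus "(f k i \<omega> + D k i \<omega>)\<^sup>2 \<le> 2 * (f k i \<omega>)\<^sup>2 + 2 * (D k i \<omega>)\<^sup>2"
        by (simp add: power2_sum power2_diff)
    qed (auto intro!: L2_square g f D)
    also have "\<dots> = 2 * (\<Sum>i<N. expectation (\<lambda>\<omega>. (f k i \<omega>)\<^sup>2)) + 2 * (\<Sum>i<N. expectation (\<lambda>\<omega>. (D k i \<omega>)\<^sup>2))"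
      by (simp add: L2_square f D sum.distrib sum_distrib_left)
    also have "(\<Sum>i<N. expectation (\<lambda>\<omega>. (D k i \<omega>)\<^sup>2)) \<le> (\<Sum>i<N. K * T k)"
      by (intro sum_mono) (auto simp: T_def intro!: K)
    also have "(\<Sum>i<N. expectation (\<lambda>\<omega>. (f k i \<omega>)\<^sup>2)) = expectation (\<lambda>\<omega>. \<Sum>i<N. (f k i \<omega>)\<^sup>2)"
      by (simp add: L2_square f)
    also have "\<dots> \<le> expectation (\<lambda>\<omega>. C1\<^sup>2 * (\<Sum>i<N. (x k i \<omega>)\<^sup>2))"
      by (intro integral_mono f_le) (auto intro!: L2_square f x)
    also have "\<dots> = C1\<^sup>2 * (T k - 1)"
      by (simp add: T_def L2_square x)
    also have "\<dots> \<le> C1\<^sup>2 * T k" by (intro mult_left_mono) auto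
    finally show ?thesis by (simp add: G_def algebra_simps)
  qed
  \<comment> \<open>In the expansion of the new squared norm the inner product with the drift is
    minus the dissipation, and the inner product with the noise has mean zero by
    \<open>orth\<close>.\<close>
  have T_step: "T (Suc k) \<le> T k - 2 * (\<alpha> k * expectation (w k)) + (\<alpha> k)\<^sup>2 * (G * T k)" for k
  proof -
    have "(\<Sum>i<N. expectation (\<lambda>\<omega>. (x (Suc k) i \<omega>)\<^sup>2))
       = (\<Sum>i<N. expectation (\<lambda>\<omega>. (x k i \<omega>)\<^sup>2 + 2 * \<alpha> k * (x k i \<omega> * f k i \<omega>)
            + 2 * \<alpha> k * (x k i \<omega> * D k i \<omega>) + (\<alpha> k)\<^sup>2 * (f k i \<omega> + D k i \<omega>)\<^sup>2))"
      by (intro sum.cong refl Bochner_Integration.integral_cong)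
        (auto simp: step f_def power2_eq_square algebra_simps)
    also have "\<dots> = (\<Sum>i<N. expectation (\<lambda>\<omega>. (x k i \<omega>)\<^sup>2) + 2 * \<alpha> k * expectation (\<lambda>\<omega>. x k i \<omega> * f k i \<omega>)
            + (\<alpha> k)\<^sup>2 * expectation (\<lambda>\<omega>. (f k i \<omega> + D k i \<omega>)\<^sup>2))"
      by (intro sum.cong refl) (simp add: L2_square L2_mult x f D g orth)
    also have "\<dots> = T k - 1 + 2 * \<alpha> k * (\<Sum>i<N. expectation (\<lambda>\<omega>. x k i \<omega> * f k i \<omega>))
            + (\<alpha> k)\<^sup>2 * (\<Sum>i<N. expectation (\<lambda>\<omega>. (f k i \<omega> + D k i \<omega>)\<^sup>2))"
      by (simp add: sum.distrib sum_distrib_left T_def)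
    also have "(\<Sum>i<N. expectation (\<lambda>\<omega>. x k i \<omega> * f k i \<omega>)) = - expectation (w k)"
      by (simp add: ext[of "w k", OF w_eq] L2_mult x f)
    finally show ?thesis using mult_left_mono[OF G[of k], of "(\<alpha> k)\<^sup>2"] by (simp add: T_def)
  qed
  \<comment> \<open>Discarding the dissipation in \<open>T_step\<close> leaves the growth factor 1 +
    G \<alpha>(k)^2, whose excess over 1 is summable.\<close>
  have "\<exists>B. \<forall>k. T k \<le> B"
  proof (rule gronwall_bounded)
    show "summable (\<lambda>k. G * (\<alpha> k)\<^sup>2)" by (intro summable_mult \<alpha>)
    show "T (Suc k) \<le> (1 + G * (\<alpha> k)\<^sup>2) * T k" for k
      using T_step[of k] mult_nonneg_nonneg[OF \<alpha>(1)[of k] w0[of k]] by (simp add: algebra_simps)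
    show "0 \<le> T k" for k using T1[of k] by simp
  qed (use G0 in auto)
  then obtain B where B: "\<And>k. T k \<le> B" by blast
  have B0: "B \<ge> 0" using B[of 0] T1[of 0] by linarith
  \<comment> \<open>\<open>T_step\<close> is used a second time and telescoped, now keeping the
    dissipation and using the bound \<open>B\<close> in the quadratic term.\<close>
  have a_sum: "summable (\<lambda>k. \<alpha> k * expectation (w k))"
  proof (rule summableI_nonneg_bounded)
    fix n
    show "0 \<le> \<alpha> n * expectation (w n)" by (intro mult_nonneg_nonneg \<alpha> w0)
    have "T n + 2 * (\<Sum>k<n. \<alpha> k * expectation (w k)) \<le> T 0 + G * B * (\<Sum>k<n. (\<alpha> k)\<^sup>2)" for n
    proof (induction n)
      case (Suc n)
      have "(\<alpha> n)\<^sup>2 * (G * T n) \<le> (\<alpha> n)\<^sup>2 * (G * B)"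
        by (intro mult_left_mono B G0) auto
      with Suc T_step[of n] show ?case by (simp add: algebra_simps)
    qed simp
    from this[of n] T1[of n] have "2 * (\<Sum>k<n. \<alpha> k * expectation (w k)) \<le> T 0 + G * B * (\<Sum>k<n. (\<alpha> k)\<^sup>2)"
      by linarith
    also have "\<dots> \<le> T 0 + G * B * (\<Sum>k. (\<alpha> k)\<^sup>2)"
      using G0 B0 \<alpha> by (intro add_left_mono mult_left_mono sum_le_suminf) auto
    finally show "(\<Sum>k<n. \<alpha> k * expectation (w k)) \<le> (T 0 + G * B * (\<Sum>k. (\<alpha> k)\<^sup>2)) / 2" by simp
  qed
  define v where "v k = expectation (\<lambda>\<omega>. \<Sum>i<N. (y k i \<omega>)\<^sup>2)" for k
  have v_le: "v k \<le> C2 * expectation (w k)" for k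
  proof -
    have "v k \<le> expectation (\<lambda>\<omega>. C2 * w k \<omega>)"
      unfolding v_def by (intro integral_mono C2) (auto intro!: L2_square y w)
    thus ?thesis by simp
  qed
  \<comment> \<open>\<open>y\<close> is a linear combination of the current states, so it inherits
    their orthogonality to the noise.\<close>
  have yD: "expectation (\<lambda>\<omega>. y k i \<omega> * D k i \<omega>) = 0" if i: "i < N" for k i
  proof -
    have "expectation (\<lambda>\<omega>. y k i \<omega> * D k i \<omega>)
       = expectation (\<lambda>\<omega>. x k i \<omega> * D k i \<omega> - (\<Sum>j<N. x k j \<omega> * D k i \<omega>) / real N)"
      by (simp add: y_def left_diff_distrib sum_distrib_right)
    also have "\<dots> = expectation (\<lambda>\<omega>. x k i \<omega> * D k i \<omega>)
       - expectation (\<lambda>\<omega>. (\<Sum>j<N. x k j \<omega> * D k i \<omega>) / real N)"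
      using i by (intro Bochner_Integration.integral_diff) (auto intro!: L2_mult x D)
    also have "\<dots> = 0" using i by (simp add: L2_mult x D orth)
    finally show ?thesis .
  qed
  have "v \<longlonglongrightarrow> 0"
  proof (rule almost_decreasing_tendsto_0)
    show "0 \<le> v k" for k unfolding v_def by (intro Bochner_Integration.integral_nonneg sum_nonneg) auto
    \<comment> \<open>The drift is not shown to decrease the disagreement. Its contribution 2 y.f is
      only bounded by |f|^2 + |y|^2 \<le> (C1 + C2) w, and the sum of \<alpha> times the expectation
      of this is already known to be finite.\<close>
    show "summable (\<lambda>k. (C1 + C2) * (\<alpha> k * expectation (w k)) + G * B * (\<alpha> k)\<^sup>2)"
      by (intro summable_add summable_mult a_sum \<alpha>)
    show "summable (\<lambda>k. \<alpha> k * v k)"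
    proof (rule summable_comparison_test')
      show "summable (\<lambda>k. C2 * (\<alpha> k * expectation (w k)))" by (intro summable_mult a_sum)
      show "norm (\<alpha> k * v k) \<le> C2 * (\<alpha> k * expectation (w k))" if "k \<ge> 0" for k
        using mult_left_mono[OF v_le[of k] \<alpha>(1)[of k]] \<alpha>(1)[of k] \<open>\<And>k. 0 \<le> v k\<close>[of k]
        by (simp add: abs_mult mult_ac)
    qed
    fix k
    have "v (Suc k) \<le> expectation (\<lambda>\<omega>. \<Sum>i<N. (y k i \<omega>)\<^sup>2 + \<alpha> k * ((f k i \<omega>)\<^sup>2 + (y k i \<omega>)\<^sup>2)
        + 2 * \<alpha> k * (y k i \<omega> * D k i \<omega>) + (\<alpha> k)\<^sup>2 * (f k i \<omega> + D k i \<omega>)\<^sup>2)"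
      unfolding v_def
    proof (rule integral_mono)
      fix \<omega> assume \<omega>: "\<omega> \<in> space M"
      \<comment> \<open>The new states are measured against the old mean, about which their squared
        deviations can only be larger.\<close>
      have "(\<Sum>i<N. (y (Suc k) i \<omega>)\<^sup>2) \<le> (\<Sum>i<N. (x (Suc k) i \<omega> - (\<Sum>j<N. x k j \<omega>) / real N)\<^sup>2)"
        unfolding y_def by (rule sum_sq_average_le)
      also have "\<dots> \<le> (\<Sum>i<N. (y k i \<omega>)\<^sup>2 + \<alpha> k * ((f k i \<omega>)\<^sup>2 + (y k i \<omega>)\<^sup>2)
        + 2 * \<alpha> k * (y k i \<omega> * D k i \<omega>) + (\<alpha> k)\<^sup>2 * (f k i \<omega> + D k i \<omega>)\<^sup>2)"
      proof (rule sum_mono)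
        fix i assume i: "i \<in> {..<N}"
        have "x (Suc k) i \<omega> - (\<Sum>j<N. x k j \<omega>) / real N = y k i \<omega> + \<alpha> k * (f k i \<omega> + D k i \<omega>)"
          using i \<omega> by (simp add: step y_def f_def)
        hence "(x (Suc k) i \<omega> - (\<Sum>j<N. x k j \<omega>) / real N)\<^sup>2 = (y k i \<omega>)\<^sup>2 + \<alpha> k * (2 * (y k i \<omega> * f k i \<omega>))
           + 2 * \<alpha> k * (y k i \<omega> * D k i \<omega>) + (\<alpha> k)\<^sup>2 * (f k i \<omega> + D k i \<omega>)\<^sup>2"
          by (simp add: power2_eq_square algebra_simps)
        moreover have "2 * (y k i \<omega> * f k i \<omega>) \<le> (f k i \<omega>)\<^sup>2 + (y k i \<omega>)\<^sup>2"
          using zero_le_power2[of "f k i \<omega> - y k i \<omega>"] by (simp add: power2_diff mult_ac)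
        hence "\<alpha> k * (2 * (y k i \<omega> * f k i \<omega>)) \<le> \<alpha> k * ((f k i \<omega>)\<^sup>2 + (y k i \<omega>)\<^sup>2)"
          by (rule mult_left_mono) (rule \<alpha>)
        ultimately show "(x (Suc k) i \<omega> - (\<Sum>j<N. x k j \<omega>) / real N)\<^sup>2 \<le> (y k i \<omega>)\<^sup>2 + \<alpha> k * ((f k i \<omega>)\<^sup>2 + (y k i \<omega>)\<^sup>2)
        + 2 * \<alpha> k * (y k i \<omega> * D k i \<omega>) + (\<alpha> k)\<^sup>2 * (f k i \<omega> + D k i \<omega>)\<^sup>2" by linarith
      qed
      finally show "(\<Sum>i<N. (y (Suc k) i \<omega>)\<^sup>2) \<le> \<dots>" .
    qed (intro Bochner_Integration.integrable_sum Bochner_Integration.integrable_add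
        integrable_mult_right L2_square L2_mult y f D g; simp)+
    also have "\<dots> = (\<Sum>i<N. expectation (\<lambda>\<omega>. (y k i \<omega>)\<^sup>2)
        + \<alpha> k * (expectation (\<lambda>\<omega>. (f k i \<omega>)\<^sup>2) + expectation (\<lambda>\<omega>. (y k i \<omega>)\<^sup>2))
        + (\<alpha> k)\<^sup>2 * expectation (\<lambda>\<omega>. (f k i \<omega> + D k i \<omega>)\<^sup>2))"
      by (simp add: L2_square L2_mult y f D g yD)
    also have "\<dots> = v k + \<alpha> k * (expectation (\<lambda>\<omega>. \<Sum>i<N. (f k i \<omega>)\<^sup>2) + v k)
        + (\<alpha> k)\<^sup>2 * (\<Sum>i<N. expectation (\<lambda>\<omega>. (f k i \<omega> + D k i \<omega>)\<^sup>2))"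
      by (simp add: v_def L2_square y f sum.distrib sum_distrib_left distrib_left)
    also have "\<dots> \<le> v k + \<alpha> k * (C1 * expectation (w k) + C2 * expectation (w k)) + (\<alpha> k)\<^sup>2 * (G * B)"
    proof (intro add_mono mult_left_mono order_refl v_le \<alpha>)
      have "expectation (\<lambda>\<omega>. \<Sum>i<N. (f k i \<omega>)\<^sup>2) \<le> expectation (\<lambda>\<omega>. C1 * w k \<omega>)"
        by (intro integral_mono C1) (auto intro!: L2_square f w)
      thus "expectation (\<lambda>\<omega>. \<Sum>i<N. (f k i \<omega>)\<^sup>2) \<le> C1 * expectation (w k)" by simp
      show "(\<Sum>i<N. expectation (\<lambda>\<omega>. (f k i \<omega> + D k i \<omega>)\<^sup>2)) \<le> G * B"
        using G[of k] mult_left_mono[OF B[of k] G0] by linarith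
    qed auto
    finally show "v (Suc k) \<le> v k + ((C1 + C2) * (\<alpha> k * expectation (w k)) + G * B * (\<alpha> k)\<^sup>2)"
      by (simp add: algebra_simps)
  qed (use \<alpha> in auto)
  thus ?thesis unfolding v_def y_def .
qed

section \<open>Moments of complex Gaussians\<close>

text \<open>The circular density factors into two centred normal densities of variance v/2, and the
  other coordinate integrates to 1. Letting \<open>b\<close> range over \<open>Basis\<close> treats
  real and imaginary parts at once.\<close>

lemma (in prob_space) complex_normal_coordinate:
  fixes b :: complex
  assumes Z: "complex_normal M Z v" and v: "v > 0" and b: "b \<in> Basis"
  shows "distributed M lborel (\<lambda>\<omega>. Z \<omega> \<bullet> b) (normal_density 0 (sqrt (v / 2)))"
proof -
  let ?g = "normal_density 0 (sqrt (v / 2))"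
  let ?d = "\<lambda>z. ennreal (exp (- (cmod z)\<^sup>2 / v) / (pi * v))"
  have D: "distributed M lborel Z ?d" using Z by (simp add: complex_normal_def)
  have [measurable]: "Z \<in> borel_measurable M" using D by (auto simp: distributed_def)
  have g: "?g x = exp (- x\<^sup>2 / v) / sqrt (pi * v)" for x
    using v by (simp add: normal_density_def)
  have gg: "?g x * ?g y = exp (- (x\<^sup>2 + y\<^sup>2) / v) / (pi * v)" for x y
  proof -
    have "exp (- (x\<^sup>2 + y\<^sup>2) / v) = exp (- x\<^sup>2 / v) * exp (- y\<^sup>2 / v)"
      by (simp add: exp_add[symmetric] add_divide_distrib diff_divide_distrib)
    thus ?thesis using v by (simp add: g)
  qed
  have one: "(\<integral>\<^sup>+ x. ennreal (?g x) \<partial>lborel) = 1"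
    using v prob_space.emeasure_space_1[OF prob_space_normal_density[of "sqrt (v / 2)" 0]]
    by (simp add: emeasure_density)
  have "distr M lborel (\<lambda>\<omega>. Z \<omega> \<bullet> b) = density lborel (\<lambda>x. ennreal (?g x))"
  proof (rule measure_eqI)
    fix A assume "A \<in> sets (distr M lborel (\<lambda>\<omega>. Z \<omega> \<bullet> b))"
    hence A[measurable]: "A \<in> sets borel" by simp
    \<comment> \<open>Coordinate \<open>b\<close> is restricted to \<open>A\<close> while the other
      one is left free, so that the event becomes a product over \<open>Basis\<close> and Tonelli
      applies.\<close>
    define F where "F c x = ennreal (?g x) * indicator (if c = b then A else UNIV) x" for c :: complex and x :: real
    have F[measurable]: "F c \<in> borel_measurable borel" for c
      unfolding F_def by (cases "c = b") (simp_all, measurable)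
    have pre[measurable]: "(\<lambda>z. z \<bullet> b) -` A \<in> sets borel"
      using measurable_sets[of "\<lambda>z. z \<bullet> b" borel borel A] by simp
    have "emeasure (distr M lborel (\<lambda>\<omega>. Z \<omega> \<bullet> b)) A = emeasure (distr M lborel Z) ((\<lambda>z. z \<bullet> b) -` A)"
      by (simp add: emeasure_distr) (auto intro!: arg_cong2[of _ _ _ _ emeasure])
    also have "distr M lborel Z = density lborel ?d" using D by (simp add: distributed_def)
    also have "emeasure \<dots> ((\<lambda>z. z \<bullet> b) -` A) = (\<integral>\<^sup>+ z. ?d z * indicator ((\<lambda>z. z \<bullet> b) -` A) z \<partial>lborel)"
      by (intro emeasure_density) auto
    also have "\<dots> = (\<integral>\<^sup>+ z. (\<Prod>c\<in>Basis. F c (z \<bullet> c)) \<partial>lborel)"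
    proof (intro nn_integral_cong)
      fix z :: complex
      have "?d z = ennreal (?g (Re z)) * ennreal (?g (Im z))"
        by (simp add: ennreal_mult'[symmetric] gg cmod_power2)
      moreover from b have "b = 1 \<or> b = \<i>" by (simp add: Basis_complex_def)
      ultimately show "?d z * indicator ((\<lambda>z. z \<bullet> b) -` A) z = (\<Prod>c\<in>Basis. F c (z \<bullet> c))"
        by (elim disjE) (simp_all add: Basis_complex_def F_def indicator_def mult_ac)
    qed
    also have "\<dots> = (\<Prod>c\<in>Basis. \<integral>\<^sup>+ x. F c x \<partial>lborel)"
      by (intro nn_integral_lborel_prod) auto
    also have "\<dots> = (\<integral>\<^sup>+ x. F b x \<partial>lborel) * (\<Prod>c\<in>Basis - {b}. \<integral>\<^sup>+ x. F c x \<partial>lborel)"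
      using b by (intro prod.remove) auto
    also have "(\<Prod>c\<in>Basis - {b}. \<integral>\<^sup>+ x. F c x \<partial>lborel) = 1"
      by (intro prod.neutral) (auto simp: F_def one)
    also have "(\<integral>\<^sup>+ x. F b x \<partial>lborel) * 1 = emeasure (density lborel (\<lambda>x. ennreal (?g x))) A"
      by (simp add: F_def emeasure_density)
    finally show "emeasure (distr M lborel (\<lambda>\<omega>. Z \<omega> \<bullet> b)) A = emeasure (density lborel (\<lambda>x. ennreal (?g x))) A" .
  qed simp
  thus ?thesis by (simp add: distributed_def)
qed

lemma (in prob_space) complex_normal_coordinate_moments:
  fixes b :: complex
  assumes Z: "complex_normal M Z v" and v: "v > 0" and b: "b \<in> Basis"
  shows "integrable M (\<lambda>\<omega>. (Z \<omega> \<bullet> b) ^ k)"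
    and "expectation (\<lambda>\<omega>. Z \<omega> \<bullet> b) = 0"
    and "expectation (\<lambda>\<omega>. (Z \<omega> \<bullet> b)\<^sup>2) = v / 2"
    and "expectation (\<lambda>\<omega>. (Z \<omega> \<bullet> b) ^ 4) = 3 * v\<^sup>2 / 4"
proof -
  let ?s = "sqrt (v / 2)"
  note D = complex_normal_coordinate[OF Z v b]
  have s: "?s > 0" using v by simp
  show "integrable M (\<lambda>\<omega>. (Z \<omega> \<bullet> b) ^ k)"
    using distributed_integrable[OF D, of "\<lambda>x. x ^ k"] integrable_normal_moment[OF s, of 0 k] by simp
  have mom: "expectation (\<lambda>\<omega>. (Z \<omega> \<bullet> b) ^ k) = (\<integral>x. normal_density 0 ?s x * (x - 0) ^ k \<partial>lborel)" for k
    using distributed_integral[OF D, of "\<lambda>x. x ^ k"] by simp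
  show "expectation (\<lambda>\<omega>. Z \<omega> \<bullet> b) = 0"
    using mom[of 1] integral_normal_moment_odd[OF s, of 0 0] by simp
  show "expectation (\<lambda>\<omega>. (Z \<omega> \<bullet> b)\<^sup>2) = v / 2"
    using mom[of 2] integral_normal_moment_even[OF s, of 0 1] v by simp
  \<comment> \<open>The even moment formula with variance s^2 = v/2 reads 24 / (2 (2/s^2)^2) = 3 s^4
    = 3 v^2/4.\<close>
  have "fact 4 = (24::real)" by (simp add: fact_numeral)
  thus "expectation (\<lambda>\<omega>. (Z \<omega> \<bullet> b) ^ 4) = 3 * v\<^sup>2 / 4"
    using mom[of 4] integral_normal_moment_even[OF s, of 0 2] v
    by (simp add: power_divide field_simps)
qed

text \<open>The fourth moment is bounded through (Re^2 + Im^2)^2 \<le> 2 Re^4 + 2 Im^4, which needs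
  only the coordinate moments. The exact value is 2 v^2, but any multiple of v^2 serves.\<close>

lemma (in prob_space) complex_normal_moments:
  assumes Z: "complex_normal M Z v" and v: "v > 0"
  shows "Z \<in> borel_measurable M"
    and "integrable M (\<lambda>\<omega>. Re (Z \<omega>))" and "integrable M (\<lambda>\<omega>. Im (Z \<omega>))"
    and "expectation (\<lambda>\<omega>. Re (Z \<omega>)) = 0" and "expectation (\<lambda>\<omega>. Im (Z \<omega>)) = 0"
    and "L2 M (\<lambda>\<omega>. (cmod (Z \<omega>))\<^sup>2)"
    and "expectation (\<lambda>\<omega>. (cmod (Z \<omega>))\<^sup>2) = v"
    and "expectation (\<lambda>\<omega>. ((cmod (Z \<omega>))\<^sup>2)\<^sup>2) \<le> 3 * v\<^sup>2"
proof -
  have B: "1 \<in> (Basis :: complex set)" "\<i> \<in> (Basis :: complex set)" by (auto simp: Basis_complex_def)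
  note R = complex_normal_coordinate_moments[OF Z v B(1), simplified]
  note I = complex_normal_coordinate_moments[OF Z v B(2), simplified]
  show m[measurable]: "Z \<in> borel_measurable M" using Z by (simp add: complex_normal_def distributed_def)
  show "integrable M (\<lambda>\<omega>. Re (Z \<omega>))" "integrable M (\<lambda>\<omega>. Im (Z \<omega>))"
    using R(1)[of 1] I(1)[of 1] by simp_all
  show "expectation (\<lambda>\<omega>. Re (Z \<omega>)) = 0" "expectation (\<lambda>\<omega>. Im (Z \<omega>)) = 0"
    using R I by simp_all
  show "expectation (\<lambda>\<omega>. (cmod (Z \<omega>))\<^sup>2) = v"
    using R I by (simp add: cmod_power2)
  have le: "((cmod z)\<^sup>2)\<^sup>2 \<le> 2 * Re z ^ 4 + 2 * Im z ^ 4" for z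
    using zero_le_power2[of "(Re z)\<^sup>2 - (Im z)\<^sup>2"]
    by (simp add: cmod_power2 power2_sum power2_diff flip: power_mult)
  show L: "L2 M (\<lambda>\<omega>. (cmod (Z \<omega>))\<^sup>2)"
    unfolding L2_def
  proof
    show "integrable M (\<lambda>\<omega>. ((cmod (Z \<omega>))\<^sup>2)\<^sup>2)"
      by (rule Bochner_Integration.integrable_bound[of M "\<lambda>\<omega>. 2 * Re (Z \<omega>) ^ 4 + 2 * Im (Z \<omega>) ^ 4"])
        (use R(1)[of 4] I(1)[of 4] le in \<open>auto intro!: order_trans[OF _ abs_ge_self]\<close>)
  qed measurable
  have "expectation (\<lambda>\<omega>. ((cmod (Z \<omega>))\<^sup>2)\<^sup>2) \<le> expectation (\<lambda>\<omega>. 2 * Re (Z \<omega>) ^ 4 + 2 * Im (Z \<omega>) ^ 4)"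
    using L2_square[OF L] R I by (intro integral_mono le) auto
  also have "\<dots> = 3 * v\<^sup>2" using R I by simp
  finally show "expectation (\<lambda>\<omega>. ((cmod (Z \<omega>))\<^sup>2)\<^sup>2) \<le> 3 * v\<^sup>2" .
qed

section \<open>Independent families and quadratic noise\<close>

locale indep_family = prob_space +
  fixes Y :: "'s \<Rightarrow> 'a \<Rightarrow> complex"
  assumes indep: "indep_vars (\<lambda>_. borel) Y UNIV"
begin

text \<open>Packaging the sigma-algebra as a measure on the same space lets "is a function of the
  sources in \<open>S\<close>" be stated as \<open>borel_measurable (gen S)\<close>.\<close>

definition gen :: "'s set \<Rightarrow> 'a measure" where
  "gen S = sigma (space M) (\<Union>s\<in>S. {Y s -` A \<inter> space M | A. A \<in> sets borel})"

lemma space_gen [simp]: "space (gen S) = space M"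
  by (simp add: gen_def space_measure_of_conv)

lemma sets_gen: "sets (gen S) = sigma_sets (space M) (\<Union>s\<in>S. {Y s -` A \<inter> space M | A. A \<in> sets borel})"
  unfolding gen_def by (rule sets_measure_of) auto

lemma measurable_gen: "s \<in> S \<Longrightarrow> Y s \<in> borel_measurable (gen S)"
  by (rule measurableI) (auto simp: sets_gen)

lemma measurable_gen_mono:
  assumes "S \<subseteq> T" "f \<in> measurable (gen S) N" shows "f \<in> measurable (gen T) N"
proof -
  have "sets (gen S) \<subseteq> sets (gen T)"
    unfolding sets_gen by (rule sigma_sets_mono') (use assms in blast)
  thus ?thesis using assms(2) by (auto simp: measurable_def)
qed

lemma measurable_gen_M:
  assumes f: "f \<in> measurable (gen S) N" shows "f \<in> measurable M N"
proof -
  have "Y s -` A \<inter> space M \<in> events" if "A \<in> sets borel" for s A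
    using indep that by (auto simp: indep_vars_def2 intro: measurable_sets)
  hence "sets (gen S) \<subseteq> events"
    unfolding sets_gen by (intro sets.sigma_sets_subset) blast
  thus ?thesis using f by (auto simp: measurable_def)
qed

text \<open>Disjoint blocks of an independent family generate independent sigma-algebras, because
  the preimages of Borel sets under each member are closed under intersection. \<open>f\<close> and
  \<open>g\<close> generate sub-sigma-algebras of the two blocks.\<close>

lemma indep_var_gen:
  assumes ST: "S \<inter> T = {}" and f: "f \<in> measurable (gen S) A" and g: "g \<in> measurable (gen T) B"
  shows "indep_var A f B g"
proof -
  let ?E = "\<lambda>s. {Y s -` A \<inter> space M | A. A \<in> sets borel}"
  have "indep_sets (\<lambda>j. sigma_sets (space M) (\<Union>i\<in>case_bool S T j. ?E i)) UNIV"
  proof (rule indep_sets_collect_sigma)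
    show "indep_sets ?E (\<Union>j. case_bool S T j)"
      by (rule indep_sets_mono_index[of _ UNIV]) (use indep in \<open>auto simp: indep_vars_def2\<close>)
    show "Int_stable (?E i)" for i
    proof (rule Int_stableI)
      fix a b assume "a \<in> ?E i" "b \<in> ?E i"
      then obtain A B where "a = Y i -` A \<inter> space M" "b = Y i -` B \<inter> space M"
        and [measurable]: "A \<in> sets borel" "B \<in> sets borel" by blast
      thus "a \<inter> b \<in> ?E i" by (intro CollectI exI[of _ "A \<inter> B"]) auto
    qed
    show "disjoint_family_on (case_bool S T) UNIV"
      using ST by (auto simp: disjoint_family_on_def split: bool.split)
  qed
  hence "indep_sets (case_bool (sigma_sets (space M) { f -` X \<inter> space M | X. X \<in> sets A})
      (sigma_sets (space M) { g -` X \<inter> space M | X. X \<in> sets B})) UNIV"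
  proof (rule indep_sets_mono_sets)
    have gen: "sigma_sets (space M) { k -` X \<inter> space M | X. X \<in> sets C} \<subseteq> sets (gen R)"
      if "k \<in> measurable (gen R) C" for k :: "'a \<Rightarrow> 'e" and R C
      using sets.sigma_sets_subset[of "{ k -` X \<inter> space M | X. X \<in> sets C}" "gen R"] measurable_sets[OF that] by auto
    show "case_bool (sigma_sets (space M) { f -` X \<inter> space M | X. X \<in> sets A})
      (sigma_sets (space M) { g -` X \<inter> space M | X. X \<in> sets B}) i
      \<subseteq> sigma_sets (space M) (\<Union>i\<in>case_bool S T i. ?E i)" for i
      using gen[OF f] gen[OF g] by (cases i) (auto simp: sets_gen)
  qed
  thus ?thesis
    unfolding indep_var_eq indep_set_def using measurable_gen_M f g by blast
qed

lemma indep_mult: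
  fixes f g :: "'a \<Rightarrow> real"
  assumes "S \<inter> T = {}" "f \<in> borel_measurable (gen S)" "g \<in> borel_measurable (gen T)"
    and "integrable M f" "integrable M g"
  shows "integrable M (\<lambda>\<omega>. f \<omega> * g \<omega>)"
    and "expectation (\<lambda>\<omega>. f \<omega> * g \<omega>) = expectation f * expectation g"
  using indep_var_integrable indep_var_lebesgue_integral indep_var_gen assms by blast+

text \<open>A product of two \<open>L2\<close> functions is in general merely integrable. Here the
  squares are independent and integrable, so the square of the product is integrable as
  well.\<close>

lemma L2_indep_mult:
  assumes ST: "S \<inter> T = {}" and f: "f \<in> borel_measurable (gen S)" "L2 M f"
    and g: "g \<in> borel_measurable (gen T)" "L2 M g"
  shows "L2 M (\<lambda>\<omega>. f \<omega> * g \<omega>)"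
    and "expectation (\<lambda>\<omega>. (f \<omega> * g \<omega>)\<^sup>2) = expectation (\<lambda>\<omega>. (f \<omega>)\<^sup>2) * expectation (\<lambda>\<omega>. (g \<omega>)\<^sup>2)"
proof -
  have m: "(\<lambda>\<omega>. (f \<omega>)\<^sup>2) \<in> borel_measurable (gen S)" "(\<lambda>\<omega>. (g \<omega>)\<^sup>2) \<in> borel_measurable (gen T)"
    using f g by measurable
  note * = indep_mult[OF ST m L2_square[OF f(2)] L2_square[OF g(2)]]
  show "L2 M (\<lambda>\<omega>. f \<omega> * g \<omega>)"
    unfolding L2_def using * L2_measurable[OF f(2)] L2_measurable[OF g(2)] by (simp add: power_mult_distrib)
  show "expectation (\<lambda>\<omega>. (f \<omega> * g \<omega>)\<^sup>2) = expectation (\<lambda>\<omega>. (f \<omega>)\<^sup>2) * expectation (\<lambda>\<omega>. (g \<omega>)\<^sup>2)"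
    using * by (simp add: power_mult_distrib)
qed

text \<open>The real part of the product is Re Z Re R - Im Z Im R, and each real product factors
  with a vanishing mean.\<close>

lemma expectation_Re_mult_eq_0:
  assumes ST: "S \<inter> T = {}" and Z: "Z \<in> borel_measurable (gen S)" and R: "R \<in> borel_measurable (gen T)"
    and ZR: "integrable M (\<lambda>\<omega>. Re (Z \<omega>))" "integrable M (\<lambda>\<omega>. Im (Z \<omega>))"
    and Z0: "expectation (\<lambda>\<omega>. Re (Z \<omega>)) = 0" "expectation (\<lambda>\<omega>. Im (Z \<omega>)) = 0"
    and RI: "integrable M R"
  shows "expectation (\<lambda>\<omega>. Re (Z \<omega> * R \<omega>)) = 0"
proof -
  have m: "(\<lambda>\<omega>. Re (Z \<omega>)) \<in> borel_measurable (gen S)" "(\<lambda>\<omega>. Re (R \<omega>)) \<in> borel_measurable (gen T)"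
    "(\<lambda>\<omega>. Im (Z \<omega>)) \<in> borel_measurable (gen S)" "(\<lambda>\<omega>. Im (R \<omega>)) \<in> borel_measurable (gen T)"
    using Z R by measurable
  have R': "integrable M (\<lambda>\<omega>. Re (R \<omega>))" "integrable M (\<lambda>\<omega>. Im (R \<omega>))" using RI by auto
  show ?thesis
    using indep_mult[OF ST m(1,2) ZR(1) R'(1)] indep_mult[OF ST m(3,4) ZR(2) R'(2)] Z0 by simp
qed

text \<open>Expanding the squared modulus gives the double sum of Re(c_j cnj c_l) s_j s_l.
  Subtracting the mean of each coefficient leaves terms \<open>F p * g p\<close> with
  \<open>F p\<close> centred and independent of everything measurable in \<open>gen T\<close>, so
  all three claims reduce to factoring expectations.\<close>

lemma quadratic_noise:
  fixes c :: "nat \<Rightarrow> 'a \<Rightarrow> complex" and s :: "nat \<Rightarrow> 'a \<Rightarrow> real"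
  assumes ST: "S \<inter> T = {}"
    and c: "\<And>j. j < N \<Longrightarrow> c j \<in> borel_measurable (gen S)" "\<And>j. j < N \<Longrightarrow> L2 M (\<lambda>\<omega>. (cmod (c j \<omega>))\<^sup>2)"
    and c2: "\<And>j. j < N \<Longrightarrow> expectation (\<lambda>\<omega>. (cmod (c j \<omega>))\<^sup>2) = m j"
    and c4: "\<And>j. j < N \<Longrightarrow> expectation (\<lambda>\<omega>. ((cmod (c j \<omega>))\<^sup>2)\<^sup>2) \<le> B"
    and uncorr: "\<And>j l. j < N \<Longrightarrow> l < N \<Longrightarrow> j \<noteq> l \<Longrightarrow> expectation (\<lambda>\<omega>. Re (c j \<omega> * cnj (c l \<omega>))) = 0"
    and s: "\<And>j. j < N \<Longrightarrow> s j \<in> borel_measurable (gen T)" "\<And>j. j < N \<Longrightarrow> L2 M (\<lambda>\<omega>. (s j \<omega>)\<^sup>2)"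
  defines "D \<equiv> \<lambda>\<omega>. (cmod (\<Sum>j<N. c j \<omega> * complex_of_real (s j \<omega>)))\<^sup>2 - (\<Sum>j<N. m j * (s j \<omega>)\<^sup>2)"
  shows "L2 M D"
    and "\<And>z. z \<in> borel_measurable (gen T) \<Longrightarrow> L2 M z \<Longrightarrow> expectation (\<lambda>\<omega>. z \<omega> * D \<omega>) = 0"
    and "expectation (\<lambda>\<omega>. (D \<omega>)\<^sup>2) \<le> real N ^ 4 * B * (\<Sum>j<N. expectation (\<lambda>\<omega>. ((s j \<omega>)\<^sup>2)\<^sup>2))"
proof -
  define I where "I = {..<N} \<times> {..<N}"
  define R where "R p \<omega> = Re (c (fst p) \<omega> * cnj (c (snd p) \<omega>))" for p \<omega>
  \<comment> \<open>The mean of \<open>R p\<close>: off the diagonal it vanishes by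
    \<open>uncorr\<close>, which is why \<open>D\<close> subtracts diagonal terms only.\<close>
  define e where "e p = (if fst p = snd p then m (fst p) else 0)" for p :: "nat \<times> nat"
  define F where "F p \<omega> = R p \<omega> - e p" for p \<omega>
  define g where "g p \<omega> = s (fst p) \<omega> * s (snd p) \<omega>" for p \<omega>
  define Q where "Q = (\<Sum>j<N. expectation (\<lambda>\<omega>. ((s j \<omega>)\<^sup>2)\<^sup>2))"
  have cM: "c j \<in> borel_measurable M" and sM: "s j \<in> borel_measurable M" if "j < N" for j
    using measurable_gen_M[OF c(1)] measurable_gen_M[OF s(1)] that by auto
  have cmod_sq: "(cmod z)\<^sup>2 = Re (z * cnj z)" for z
    by (simp add: cmod_power2) (simp add: power2_eq_square)
  have D_eq: "D \<omega> = (\<Sum>p\<in>I. F p \<omega> * g p \<omega>)" for \<omega>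
  proof -
    have "(cmod (\<Sum>j<N. c j \<omega> * complex_of_real (s j \<omega>)))\<^sup>2
       = Re ((\<Sum>j<N. c j \<omega> * complex_of_real (s j \<omega>)) * cnj (\<Sum>j<N. c j \<omega> * complex_of_real (s j \<omega>)))"
      by (rule cmod_sq)
    also have "\<dots> = (\<Sum>j<N. \<Sum>l<N. R (j, l) \<omega> * g (j, l) \<omega>)"
      unfolding cnj_sum sum_product Re_sum
      by (intro sum.cong refl) (simp add: R_def g_def algebra_simps)
    finally have 1: "(cmod (\<Sum>j<N. c j \<omega> * complex_of_real (s j \<omega>)))\<^sup>2 = (\<Sum>p\<in>I. R p \<omega> * g p \<omega>)"
      by (simp add: I_def sum.cartesian_product split_def)
    have "(\<Sum>p\<in>I. e p * g p \<omega>) = (\<Sum>j<N. \<Sum>l<N. if j = l then m j * (s j \<omega> * s l \<omega>) else 0)"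
      unfolding I_def sum.cartesian_product by (intro sum.cong refl) (auto simp: e_def g_def)
    also have "\<dots> = (\<Sum>j<N. m j * (s j \<omega>)\<^sup>2)"
      by (intro sum.cong refl) (simp add: power2_eq_square)
    finally show ?thesis
      by (simp add: D_def 1 F_def left_diff_distrib sum_subtractf)
  qed
  have ab: "\<bar>a * b\<bar> \<le> a\<^sup>2 + b\<^sup>2" "2 * (a * b)\<^sup>2 \<le> (a\<^sup>2)\<^sup>2 + (b\<^sup>2)\<^sup>2" for a b :: real
  proof -
    have *: "2 * \<bar>a * b\<bar> \<le> a\<^sup>2 + b\<^sup>2" for a b :: real
      using zero_le_power2[of "\<bar>a\<bar> - \<bar>b\<bar>"] by (simp add: power2_diff abs_mult)
    show "\<bar>a * b\<bar> \<le> a\<^sup>2 + b\<^sup>2" using *[of a b] abs_ge_zero[of "a * b"] by linarith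
    show "2 * (a * b)\<^sup>2 \<le> (a\<^sup>2)\<^sup>2 + (b\<^sup>2)\<^sup>2" using *[of "a\<^sup>2" "b\<^sup>2"] by (simp add: power_mult_distrib)
  qed
  have R_le: "\<bar>R p \<omega>\<bar> \<le> cmod (c (fst p) \<omega>) * cmod (c (snd p) \<omega>)" for p \<omega>
    unfolding R_def using abs_Re_le_cmod[of "c (fst p) \<omega> * cnj (c (snd p) \<omega>)"] by (simp add: norm_mult)
  have R: "L2 M (R p)" if "p \<in> I" for p
  proof (rule L2_bound)
    show "L2 M (\<lambda>\<omega>. (cmod (c (fst p) \<omega>))\<^sup>2 + (cmod (c (snd p) \<omega>))\<^sup>2)"
      using that by (intro L2_add c) (auto simp: I_def)
    show "R p \<in> borel_measurable M"
      using cM[of "fst p"] cM[of "snd p"] that unfolding R_def I_def by auto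
    show "\<bar>R p \<omega>\<bar> \<le> \<bar>(cmod (c (fst p) \<omega>))\<^sup>2 + (cmod (c (snd p) \<omega>))\<^sup>2\<bar>" for \<omega>
      using R_le[of p \<omega>] ab(1)[of "cmod (c (fst p) \<omega>)" "cmod (c (snd p) \<omega>)"] by linarith
  qed
  have R1: "expectation (R p) = e p" if "p \<in> I" for p
    using that uncorr[of "fst p" "snd p"] c2[of "fst p"]
    unfolding cmod_sq
    by (auto simp: I_def e_def R_def[abs_def])
  have R2: "expectation (\<lambda>\<omega>. (R p \<omega>)\<^sup>2) \<le> B" if p: "p \<in> I" for p
  proof -
    have "expectation (\<lambda>\<omega>. (R p \<omega>)\<^sup>2)
      \<le> expectation (\<lambda>\<omega>. (1 / 2) * ((cmod (c (fst p) \<omega>))\<^sup>2)\<^sup>2 + (1 / 2) * ((cmod (c (snd p) \<omega>))\<^sup>2)\<^sup>2)"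
    proof (rule integral_mono)
      fix \<omega>
      have "(R p \<omega>)\<^sup>2 \<le> (cmod (c (fst p) \<omega>) * cmod (c (snd p) \<omega>))\<^sup>2"
        using R_le[of p \<omega>] by (simp add: abs_le_square_iff[symmetric])
      thus "(R p \<omega>)\<^sup>2 \<le> (1 / 2) * ((cmod (c (fst p) \<omega>))\<^sup>2)\<^sup>2 + (1 / 2) * ((cmod (c (snd p) \<omega>))\<^sup>2)\<^sup>2"
        using ab(2)[of "cmod (c (fst p) \<omega>)" "cmod (c (snd p) \<omega>)"] by linarith
    qed (use p in \<open>(intro Bochner_Integration.integrable_add integrable_mult_right L2_square R c;
        auto simp: I_def)+\<close>)
    also have "\<dots> = (1 / 2) * expectation (\<lambda>\<omega>. ((cmod (c (fst p) \<omega>))\<^sup>2)\<^sup>2) + (1 / 2) * expectation (\<lambda>\<omega>. ((cmod (c (snd p) \<omega>))\<^sup>2)\<^sup>2)"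
      using p c(2)[THEN L2_square] by (subst Bochner_Integration.integral_add) (auto simp: I_def)
    also have "\<dots> \<le> B" using c4[of "fst p"] c4[of "snd p"] p by (auto simp: I_def)
    finally show ?thesis .
  qed
  have F: "L2 M (F p)" if "p \<in> I" for p
    unfolding F_def by (intro L2_diff R L2_const that)
  have F1: "expectation (F p) = 0" if "p \<in> I" for p
    unfolding F_def using R1[OF that] L2_integrable[OF R[OF that]] by (simp add: prob_space)
  \<comment> \<open>A variance is at most the second moment.\<close>
  have F2: "expectation (\<lambda>\<omega>. (F p \<omega>)\<^sup>2) \<le> B" if p: "p \<in> I" for p
  proof -
    have "expectation (\<lambda>\<omega>. (F p \<omega>)\<^sup>2) = expectation (\<lambda>\<omega>. (R p \<omega>)\<^sup>2 - 2 * e p * R p \<omega> + (e p)\<^sup>2)"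
      by (simp add: F_def power2_diff algebra_simps)
    also have "\<dots> = expectation (\<lambda>\<omega>. (R p \<omega>)\<^sup>2) - (e p)\<^sup>2"
      using R1[OF p] L2_integrable[OF R[OF p]] L2_square[OF R[OF p]]
      by (simp add: prob_space power2_eq_square)
    finally show ?thesis using R2[OF p] zero_le_power2[of "e p"] by linarith
  qed
  have F_gen: "F p \<in> borel_measurable (gen S)" if "p \<in> I" for p
    using c(1)[of "fst p"] c(1)[of "snd p"] that unfolding F_def R_def I_def by auto
  have g_gen: "g p \<in> borel_measurable (gen T)" if "p \<in> I" for p
    using s(1)[of "fst p"] s(1)[of "snd p"] that unfolding g_def I_def by auto
  have g: "L2 M (g p)" if "p \<in> I" for p
  proof (rule L2_bound)
    show "L2 M (\<lambda>\<omega>. (s (fst p) \<omega>)\<^sup>2 + (s (snd p) \<omega>)\<^sup>2)"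
      using that by (intro L2_add s) (auto simp: I_def)
    show "g p \<in> borel_measurable M" using measurable_gen_M[OF g_gen[OF that]] .
    show "\<bar>g p \<omega>\<bar> \<le> \<bar>(s (fst p) \<omega>)\<^sup>2 + (s (snd p) \<omega>)\<^sup>2\<bar>" for \<omega>
      using ab(1)[of "s (fst p) \<omega>" "s (snd p) \<omega>"] by (simp add: g_def)
  qed
  have g2: "expectation (\<lambda>\<omega>. (g p \<omega>)\<^sup>2) \<le> Q" if p: "p \<in> I" for p
  proof -
    have Q1: "expectation (\<lambda>\<omega>. ((s j \<omega>)\<^sup>2)\<^sup>2) \<le> Q" if "j < N" for j
      unfolding Q_def by (rule member_le_sum) (use that in auto)
    have "expectation (\<lambda>\<omega>. (g p \<omega>)\<^sup>2)
      \<le> expectation (\<lambda>\<omega>. (1 / 2) * ((s (fst p) \<omega>)\<^sup>2)\<^sup>2 + (1 / 2) * ((s (snd p) \<omega>)\<^sup>2)\<^sup>2)"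
    proof (rule integral_mono)
      show "(g p \<omega>)\<^sup>2 \<le> (1 / 2) * ((s (fst p) \<omega>)\<^sup>2)\<^sup>2 + (1 / 2) * ((s (snd p) \<omega>)\<^sup>2)\<^sup>2" for \<omega>
        using ab(2)[of "s (fst p) \<omega>" "s (snd p) \<omega>"] by (simp add: g_def)
    qed (use p in \<open>(intro Bochner_Integration.integrable_add integrable_mult_right L2_square g s;
        auto simp: I_def)+\<close>)
    also have "\<dots> = (1 / 2) * expectation (\<lambda>\<omega>. ((s (fst p) \<omega>)\<^sup>2)\<^sup>2) + (1 / 2) * expectation (\<lambda>\<omega>. ((s (snd p) \<omega>)\<^sup>2)\<^sup>2)"
      using p s(2)[THEN L2_square] by (subst Bochner_Integration.integral_add) (auto simp: I_def)
    also have "\<dots> \<le> Q" using Q1[of "fst p"] Q1[of "snd p"] p by (auto simp: I_def)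
    finally show ?thesis .
  qed
  note Fg = L2_indep_mult[OF ST F_gen F g_gen g]
  show DL2: "L2 M D" unfolding D_eq by (intro L2_sum Fg)
  show "expectation (\<lambda>\<omega>. z \<omega> * D \<omega>) = 0" if z: "z \<in> borel_measurable (gen T)" "L2 M z" for z
  proof -
    \<comment> \<open>\<open>z\<close> is grouped with \<open>g p\<close>, since both are
      \<open>gen T\<close> measurable, leaving \<open>F p\<close> as the independent centred
      factor.\<close>
    have *: "integrable M (\<lambda>\<omega>. F p \<omega> * (g p \<omega> * z \<omega>)) \<and> expectation (\<lambda>\<omega>. F p \<omega> * (g p \<omega> * z \<omega>)) = 0"
      if p: "p \<in> I" for p
    proof -
      have "(\<lambda>\<omega>. g p \<omega> * z \<omega>) \<in> borel_measurable (gen T)" using g_gen[OF p] z(1) by measurable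
      from indep_mult[OF ST F_gen[OF p] this L2_integrable[OF F[OF p]] L2_mult[OF g[OF p] z(2)]]
      show ?thesis by (simp add: F1[OF p])
    qed
    have "expectation (\<lambda>\<omega>. z \<omega> * D \<omega>) = expectation (\<lambda>\<omega>. \<Sum>p\<in>I. F p \<omega> * (g p \<omega> * z \<omega>))"
      by (simp add: D_eq sum_distrib_left mult_ac)
    also have "\<dots> = 0" using * by simp
    finally show ?thesis .
  qed
  have Fg2: "expectation (\<lambda>\<omega>. (F p \<omega> * g p \<omega>)\<^sup>2) \<le> B * Q" if p: "p \<in> I" for p
  proof -
    have B0: "0 \<le> B" by (rule order_trans[OF _ F2[OF p]]) simp
    have "expectation (\<lambda>\<omega>. (F p \<omega> * g p \<omega>)\<^sup>2) = expectation (\<lambda>\<omega>. (F p \<omega>)\<^sup>2) * expectation (\<lambda>\<omega>. (g p \<omega>)\<^sup>2)"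
      using p by (intro Fg)
    also have "\<dots> \<le> B * Q" by (intro mult_mono F2 g2 p B0) simp
    finally show ?thesis .
  qed
  \<comment> \<open>Squaring a sum over the N^2 pairs costs a factor N^2; bounding all N^2 summands
    by \<open>B * Q\<close> gives the other one.\<close>
  have "expectation (\<lambda>\<omega>. (D \<omega>)\<^sup>2) \<le> expectation (\<lambda>\<omega>. (real N)\<^sup>2 * (\<Sum>p\<in>I. (F p \<omega> * g p \<omega>)\<^sup>2))"
  proof (rule integral_mono)
    show "(D \<omega>)\<^sup>2 \<le> (real N)\<^sup>2 * (\<Sum>p\<in>I. (F p \<omega> * g p \<omega>)\<^sup>2)" for \<omega>
      using sum_squared_le_sum_of_squares[of "\<lambda>p. F p \<omega> * g p \<omega>" I]
      unfolding D_eq by (simp add: I_def power2_eq_square mult_ac)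
  qed (auto intro!: L2_square DL2 Fg)
  also have "\<dots> = (real N)\<^sup>2 * (\<Sum>p\<in>I. expectation (\<lambda>\<omega>. (F p \<omega> * g p \<omega>)\<^sup>2))"
    using L2_square[OF Fg(1)] by simp
  also have "\<dots> \<le> (real N)\<^sup>2 * (\<Sum>p\<in>I. B * Q)"
    by (intro mult_left_mono sum_mono Fg2) auto
  also have "\<dots> = real N ^ 4 * B * Q"
    by (simp add: I_def eval_nat_numeral)
  finally show "expectation (\<lambda>\<omega>. (D \<omega>)\<^sup>2) \<le> real N ^ 4 * B * (\<Sum>j<N. expectation (\<lambda>\<omega>. ((s j \<omega>)\<^sup>2)\<^sup>2))"
    unfolding Q_def .
qed

end

section \<open>The consensus protocol\<close>

primrec src_time :: "src \<Rightarrow> nat" where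
  "src_time (Gam i k) = k"
| "src_time (Chan i j k) = k"
| "src_time (Noise i k) = k"

theorem theorem1:
  fixes M :: "'a measure"
    and N :: nat and E :: "nat \<Rightarrow> nat \<Rightarrow> bool"
    and \<rho> xmax :: real and u :: complex
    and p :: "nat \<Rightarrow> real" and \<Lambda> :: "nat \<Rightarrow> nat \<Rightarrow> real" and \<sigma>2 :: "nat \<Rightarrow> real"
    and \<gamma> :: "nat \<Rightarrow> nat \<Rightarrow> 'a \<Rightarrow> real"
    and h :: "nat \<Rightarrow> nat \<Rightarrow> nat \<Rightarrow> 'a \<Rightarrow> complex"
    and n :: "nat \<Rightarrow> nat \<Rightarrow> 'a \<Rightarrow> complex"
    and \<alpha> :: "nat \<Rightarrow> real"
    and x0 :: "nat \<Rightarrow> real"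
    and x :: "nat \<Rightarrow> nat \<Rightarrow> 'a \<Rightarrow> real"
  assumes prob: "prob_space M"
    and graph: "undirected_graph N E" and conn: "connected_graph N E"
    and x0_range: "\<And>i. i < N \<Longrightarrow> 0 \<le> x0 i \<and> x0 i \<le> xmax"
    and rho_pos: "\<rho> > 0" and u_unit: "cmod u = 1"
    and p_range: "\<And>i. i < N \<Longrightarrow> 0 < p i \<and> p i < 1"
    and Lambda_sym: "\<And>i j. i < N \<Longrightarrow> j < N \<Longrightarrow> \<Lambda> i j = \<Lambda> j i"
    and Lambda_pos: "\<And>i j. i < N \<Longrightarrow> j < N \<Longrightarrow> \<Lambda> i j > 0"
    and sigma_pos: "\<And>i. i < N \<Longrightarrow> \<sigma>2 i > 0"
    and indep: "prob_space.indep_vars M (\<lambda>_. borel)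
                  (\<lambda>s \<omega>. case s of Gam i k \<Rightarrow> complex_of_real (\<gamma> i k \<omega>)
                                 | Chan i j k \<Rightarrow> h i j k \<omega>
                                 | Noise i k \<Rightarrow> n i k \<omega>) UNIV"
    and gamma_01: "\<And>i k \<omega>. i < N \<Longrightarrow> \<omega> \<in> space M \<Longrightarrow> \<gamma> i k \<omega> \<in> {0, 1}"
    and gamma_prob: "\<And>i k. i < N \<Longrightarrow> measure M {\<omega> \<in> space M. \<gamma> i k \<omega> = 1} = p i"
    and h_dist: "\<And>i j k. i < N \<Longrightarrow> j < N \<Longrightarrow> complex_normal M (h i j k) (\<Lambda> i j)"
    and n_dist: "\<And>i k. i < N \<Longrightarrow> complex_normal M (n i k) (\<sigma>2 i)"
    and alpha_pos: "\<And>k. \<alpha> k > 0"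
    and alpha_sum: "\<not> summable \<alpha>"
    and alpha_sq_sum: "summable (\<lambda>k. (\<alpha> k)\<^sup>2)"
    and alpha_small: "\<And>i k. i < N \<Longrightarrow> 1 - \<alpha> k * (\<Sum>j<N. abar E \<rho> p \<Lambda> i j) > 0"
    and x_init: "\<And>i \<omega>. i < N \<Longrightarrow> x 0 i \<omega> = x0 i"
    and x_step: "\<And>k i \<omega>. i < N \<Longrightarrow>
        x (Suc k) i \<omega> =
          (1 - \<alpha> k * (\<Sum>j<N. abar E \<rho> p \<Lambda> i j)) * x k i \<omega>
          + \<alpha> k * ((cmod ((\<Sum>j\<in>{j. j < N \<and> E i j}.
                 complex_of_real (\<gamma> i k \<omega> * (1 - \<gamma> j k \<omega>) + \<gamma> j k \<omega> * (1 - \<gamma> i k \<omega>))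
                 * h i j k \<omega> * complex_of_real (sqrt (\<rho> * x k j \<omega>)) * u)
               + n i k \<omega>))\<^sup>2 - \<sigma>2 i)"
  shows "(\<forall>k. integrable M (\<lambda>\<omega>. \<Sum>i<N. (x k i \<omega> - (\<Sum>j<N. x k j \<omega>) / real N)\<^sup>2))
       \<and> (\<lambda>k. prob_space.expectation M
              (\<lambda>\<omega>. \<Sum>i<N. (x k i \<omega> - (\<Sum>j<N. x k j \<omega>) / real N)\<^sup>2)) \<longlonglongrightarrow> 0
       \<and> (\<forall>i<N. (\<lambda>k. prob_space.expectation M
              (\<lambda>\<omega>. (x k i \<omega> - (\<Sum>j<N. x k j \<omega>) / real N)\<^sup>2)) \<longlonglongrightarrow> 0)"
proof -

  \<comment> \<open>Sources of randomness and splitting of the received signal\<close>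
  define Y where "Y s \<omega> = (case s of Gam i k \<Rightarrow> complex_of_real (\<gamma> i k \<omega>)
      | Chan i j k \<Rightarrow> h i j k \<omega> | Noise i k \<Rightarrow> n i k \<omega>)" for s \<omega>
  interpret prob_space M by (rule prob)
  interpret indep_family M Y
    by unfold_locales (use indep in \<open>simp add: Y_def[abs_def]\<close>)
  have E: "i < N" "j < N" "i \<noteq> j" "E j i" if "E i j" for i j
    using graph that by (auto simp: undirected_graph_def)
  define a where "a = abar E \<rho> p \<Lambda>"
  \<comment> \<open>The inequality is strict because \<open>x k\<close> depends on the sources at
    times below \<open>k\<close>, whereas the signal received at time \<open>k\<close> uses those at
    time \<open>k\<close>.\<close>
  define past where "past k = {s. src_time s < k}" for k
  define now where "now k = {s. src_time s = k}" for k
  define \<Gamma> where "\<Gamma> k i j \<omega> = \<gamma> i k \<omega> * (1 - \<gamma> j k \<omega>) + \<gamma> j k \<omega> * (1 - \<gamma> i k \<omega>)" for k i j \<omega>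
  define q where "q i j = p i * (1 - p j) + p j * (1 - p i)" for i j
  \<comment> \<open>The diagonal index \<open>j = i\<close>, which is never a neighbour, carries the receiver noise, so that
      \<open>y\<^sub>i = \<Sum>\<^sub>j c\<^sub>i\<^sub>j s\<^sub>i\<^sub>j\<close> with \<open>c\<close> drawn in the present and \<open>s\<close> determined by the past.\<close>
  define c where "c k i j \<omega> = (if j = i then n i k \<omega> else if E i j
      then complex_of_real (\<Gamma> k i j \<omega>) * h i j k \<omega> * u else 0)" for k i j \<omega>
  define s where "s k i j \<omega> = (if j = i then 1 else sqrt (\<rho> * x k j \<omega>))" for k i j \<omega>
  define m where "m i j = (if j = i then \<sigma>2 i else if E i j then q i j * \<Lambda> i j else 0)" for i j
  \<comment> \<open>One common bound on all coefficient fourth moments: each is at most three times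
    a squared variance, and summing over all agents and pairs dominates every one.\<close>
  define B where "B = (\<Sum>i<N. 3 * (\<sigma>2 i)\<^sup>2) + (\<Sum>i<N. \<Sum>j<N. 3 * (\<Lambda> i j)\<^sup>2)"
  define D where "D k i \<omega> = (cmod (\<Sum>j<N. c k i j \<omega> * complex_of_real (s k i j \<omega>)))\<^sup>2
      - (\<Sum>j<N. m i j * (s k i j \<omega>)\<^sup>2)" for k i \<omega>

  have B: "0 \<le> B" "3 * (\<sigma>2 i)\<^sup>2 \<le> B" "3 * (\<Lambda> i j)\<^sup>2 \<le> B" if "i < N" "j < N" for i j
  proof -
    have 1: "3 * (\<sigma>2 i)\<^sup>2 \<le> (\<Sum>i<N. 3 * (\<sigma>2 i)\<^sup>2)"
      by (rule member_le_sum) (use that in auto)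
    have "3 * (\<Lambda> i j)\<^sup>2 \<le> (\<Sum>j<N. 3 * (\<Lambda> i j)\<^sup>2)"
      by (rule member_le_sum) (use that in auto)
    also have "\<dots> \<le> (\<Sum>i<N. \<Sum>j<N. 3 * (\<Lambda> i j)\<^sup>2)"
      by (rule member_le_sum[of i "{..<N}" "\<lambda>i. \<Sum>j<N. 3 * (\<Lambda> i j)\<^sup>2"])
        (use that in \<open>auto intro!: sum_nonneg\<close>)
    finally have 2: "3 * (\<Lambda> i j)\<^sup>2 \<le> (\<Sum>i<N. \<Sum>j<N. 3 * (\<Lambda> i j)\<^sup>2)" .
    have "0 \<le> 3 * (\<sigma>2 i)\<^sup>2" "0 \<le> 3 * (\<Lambda> i j)\<^sup>2" by auto
    with 1 2 show "0 \<le> B" "3 * (\<sigma>2 i)\<^sup>2 \<le> B" "3 * (\<Lambda> i j)\<^sup>2 \<le> B"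
      unfolding B_def by linarith+
  qed

  \<comment> \<open>Measurability with respect to the sources\<close>
  have \<gamma>_gen: "\<gamma> i k \<in> borel_measurable (gen S)" if "Gam i k \<in> S" for i k S
  proof -
    have [measurable]: "Y (Gam i k) \<in> borel_measurable (gen S)" by (rule measurable_gen[OF that])
    have "(\<lambda>\<omega>. Re (Y (Gam i k) \<omega>)) \<in> borel_measurable (gen S)" by measurable
    thus ?thesis by (simp add: Y_def)
  qed
  have h_gen: "h i j k \<in> borel_measurable (gen S)" if "Chan i j k \<in> S" for i j k S
    using measurable_gen[OF that] by (simp add: Y_def[abs_def])
  have n_gen: "n i k \<in> borel_measurable (gen S)" if "Noise i k \<in> S" for i k S
    using measurable_gen[OF that] by (simp add: Y_def[abs_def])
  have \<Gamma>_gen: "\<Gamma> k i j \<in> borel_measurable (gen S)" if "Gam i k \<in> S" "Gam j k \<in> S" for i j k S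
  proof -
    note [measurable] = \<gamma>_gen[OF that(1)] \<gamma>_gen[OF that(2)]
    show ?thesis unfolding \<Gamma>_def[abs_def] by measurable
  qed
  have c_gen: "c k i j \<in> borel_measurable (gen S)"
    if "Gam i k \<in> S" "Gam j k \<in> S" "Chan i j k \<in> S" "j = i \<Longrightarrow> Noise i k \<in> S" for k i j S
  proof -
    note [measurable] = \<Gamma>_gen[OF that(1,2)] h_gen[OF that(3)]
    show ?thesis using n_gen[of i k S] that(4) unfolding c_def[abs_def] by (cases "j = i"; cases "E i j") auto
  qed

  \<comment> \<open>Means of the slot indicators\<close>
  have \<Gamma>_01: "\<Gamma> k i j \<omega> \<in> {0, 1}" if "i < N" "j < N" "\<omega> \<in> space M" for k i j \<omega>
    using gamma_01[OF that(1,3), of k] gamma_01[OF that(2,3), of k] by (auto simp: \<Gamma>_def)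
  have \<gamma>_int: "integrable M (\<gamma> i k)" "expectation (\<gamma> i k) = p i" if i: "i < N" for i k
  proof -
    have [measurable]: "\<gamma> i k \<in> borel_measurable M" by (rule measurable_gen_M[OF \<gamma>_gen[of _ _ UNIV]]) simp
    show "integrable M (\<gamma> i k)"
      by (rule integrable_const_bound[where B = 1]) (auto intro!: AE_I2 dest!: gamma_01[OF i, where k = k])
    have "expectation (\<gamma> i k) = expectation (indicator {\<omega> \<in> space M. \<gamma> i k \<omega> = 1})"
      by (intro Bochner_Integration.integral_cong) (auto simp: indicator_def dest!: gamma_01[OF i, where k = k])
    thus "expectation (\<gamma> i k) = p i" by (simp add: gamma_prob[OF i])
  qed
  have \<Gamma>_int: "integrable M (\<Gamma> k i j)" "expectation (\<Gamma> k i j) = q i j"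
    if ij: "i < N" "j < N" "i \<noteq> j" for k i j
  proof -
    have prod: "integrable M (\<lambda>\<omega>. \<gamma> i k \<omega> * (1 - \<gamma> j k \<omega>))"
      "expectation (\<lambda>\<omega>. \<gamma> i k \<omega> * (1 - \<gamma> j k \<omega>)) = p i * (1 - p j)"
      if ij: "i < N" "j < N" "i \<noteq> j" for i j
    proof -
      have *: "{Gam i k} \<inter> {Gam j k} = {}" using ij by auto
      have m: "\<gamma> i k \<in> borel_measurable (gen {Gam i k})" by (rule \<gamma>_gen) simp
      have [measurable]: "\<gamma> j k \<in> borel_measurable (gen {Gam j k})" by (rule \<gamma>_gen) simp
      have m': "(\<lambda>\<omega>. 1 - \<gamma> j k \<omega>) \<in> borel_measurable (gen {Gam j k})" by measurable
      have i': "integrable M (\<lambda>\<omega>. 1 - \<gamma> j k \<omega>)" using \<gamma>_int(1) ij by simp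
      note indep_mult[OF * m m' \<gamma>_int(1)[OF ij(1)] i']
      thus "integrable M (\<lambda>\<omega>. \<gamma> i k \<omega> * (1 - \<gamma> j k \<omega>))"
        "expectation (\<lambda>\<omega>. \<gamma> i k \<omega> * (1 - \<gamma> j k \<omega>)) = p i * (1 - p j)"
        using \<gamma>_int ij by (simp_all add: prob_space)
    qed
    show "integrable M (\<Gamma> k i j)" "expectation (\<Gamma> k i j) = q i j"
      unfolding \<Gamma>_def[abs_def] q_def using ij prod by simp_all
  qed

  \<comment> \<open>Moments and uncorrelatedness of the coefficients\<close>
  note h = complex_normal_moments[OF h_dist Lambda_pos]
  note n = complex_normal_moments[OF n_dist sigma_pos]

  \<comment> \<open>\<open>\<Gamma>\<close> takes the values 0 and 1 and so equals its square, and
    \<open>u\<close> has modulus 1.\<close>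
  have c_sq: "(cmod (c k i j \<omega>))\<^sup>2 = \<Gamma> k i j \<omega> * (cmod (h i j k \<omega>))\<^sup>2"
    if "E i j" "\<omega> \<in> space M" for k i j \<omega>
    using \<Gamma>_01[of i j \<omega> k] E[of i j] that u_unit by (auto simp: c_def norm_mult)
  have c_le: "(cmod (c k i j \<omega>))\<^sup>2 \<le> (cmod (h i j k \<omega>))\<^sup>2"
    if "E i j" "\<omega> \<in> space M" for k i j \<omega>
    using \<Gamma>_01[of i j \<omega> k] E[of i j] that by (auto simp: c_sq)
  have c_M: "c k i j \<in> borel_measurable M" for k i j
    by (rule measurable_gen_M[OF c_gen[of _ _ UNIV]]) auto
  have c_L2: "L2 M (\<lambda>\<omega>. (cmod (c k i j \<omega>))\<^sup>2)" if ij: "i < N" "j < N" for k i j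
  proof -
    consider "j = i" | "j \<noteq> i" "E i j" | "j \<noteq> i" "\<not> E i j" by blast
    thus ?thesis
    proof cases
      case 2
      show ?thesis
        by (rule L2_bound[OF h(6)[of i j k]]) (use ij 2 c_M c_le in auto)
    qed (use n(6)[OF ij(1) ij(1)] L2_zero in \<open>simp_all add: c_def\<close>)
  qed
  have c_2: "expectation (\<lambda>\<omega>. (cmod (c k i j \<omega>))\<^sup>2) = m i j" if ij: "i < N" "j < N" for k i j
  proof -
    consider "j = i" | "j \<noteq> i" "E i j" | "j \<noteq> i" "\<not> E i j" by blast
    thus ?thesis
    proof cases
      case 2
      have *: "{Gam i k, Gam j k} \<inter> {Chan i j k} = {}" by auto
      have m: "\<Gamma> k i j \<in> borel_measurable (gen {Gam i k, Gam j k})" by (rule \<Gamma>_gen) auto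
      have [measurable]: "h i j k \<in> borel_measurable (gen {Chan i j k})" by (rule h_gen) auto
      have m': "(\<lambda>\<omega>. (cmod (h i j k \<omega>))\<^sup>2) \<in> borel_measurable (gen {Chan i j k})" by measurable
      have "expectation (\<lambda>\<omega>. (cmod (c k i j \<omega>))\<^sup>2) = expectation (\<lambda>\<omega>. \<Gamma> k i j \<omega> * (cmod (h i j k \<omega>))\<^sup>2)"
        using 2 by (intro Bochner_Integration.integral_cong) (auto simp: c_sq)
      also have "\<dots> = expectation (\<Gamma> k i j) * expectation (\<lambda>\<omega>. (cmod (h i j k \<omega>))\<^sup>2)"
        using ij 2 by (intro indep_mult[OF * m m'] \<Gamma>_int L2_integrable h(6)) auto
      also have "\<dots> = m i j" using ij 2 by (simp add: \<Gamma>_int h(7) m_def)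
      finally show ?thesis .
    qed (use n(7)[OF ij(1) ij(1)] in \<open>simp_all add: c_def m_def\<close>)
  qed
  have c_4: "expectation (\<lambda>\<omega>. ((cmod (c k i j \<omega>))\<^sup>2)\<^sup>2) \<le> B" if ij: "i < N" "j < N" for k i j
  proof -
    consider "j = i" | "j \<noteq> i" "E i j" | "j \<noteq> i" "\<not> E i j" by blast
    thus ?thesis
    proof cases
      case 1
      have "expectation (\<lambda>\<omega>. ((cmod (n i k \<omega>))\<^sup>2)\<^sup>2) \<le> 3 * (\<sigma>2 i)\<^sup>2"
        using n(8)[OF ij(1) ij(1)] .
      with B(2)[OF ij] 1 show ?thesis by (simp add: c_def)
    next
      case 2
      have "expectation (\<lambda>\<omega>. ((cmod (c k i j \<omega>))\<^sup>2)\<^sup>2) \<le> expectation (\<lambda>\<omega>. ((cmod (h i j k \<omega>))\<^sup>2)\<^sup>2)"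
        by (intro integral_mono L2_square c_L2 h(6) power_mono c_le) (use ij 2 in auto)
      also have "\<dots> \<le> 3 * (\<Lambda> i j)\<^sup>2" using ij by (intro h(8)) auto
      finally show ?thesis using B(3)[OF ij] by linarith
    qed (use B(1)[OF ij] in \<open>simp add: c_def\<close>)
  qed
  have c_uncorr: "expectation (\<lambda>\<omega>. Re (c k i j \<omega> * cnj (c k i l \<omega>))) = 0"
    if "i < N" "j < N" "l < N" "j \<noteq> l" for k i j l
  proof -
    have *: "expectation (\<lambda>\<omega>. Re (c k i j \<omega> * cnj (c k i l \<omega>))) = 0"
      if ijl: "i < N" "j < N" "l < N" "j \<noteq> l" "j \<noteq> i" for j l
    proof (cases "E i j")
      case True
      let ?T = "- {Chan i j k}"
      define R where "R \<omega> = complex_of_real (\<Gamma> k i j \<omega>) * u * cnj (c k i l \<omega>)" for \<omega>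
      have [measurable]: "\<Gamma> k i j \<in> borel_measurable (gen ?T)" by (rule \<Gamma>_gen) auto
      have [measurable]: "c k i l \<in> borel_measurable (gen ?T)"
        by (rule c_gen) (use ijl in auto)
      have [measurable]: "cnj \<in> borel_measurable borel"
        by (intro borel_measurable_continuous_onI continuous_intros)
      have R: "R \<in> borel_measurable (gen ?T)" unfolding R_def by measurable
      \<comment> \<open>With t = |c_il| one has |R| \<le> t \<le> 1 + t^2, the second inequality
        from (t - 1)^2 \<ge> 0.\<close>
      have "integrable M R"
      proof (rule Bochner_Integration.integrable_bound)
        show "integrable M (\<lambda>\<omega>. 1 + (cmod (c k i l \<omega>))\<^sup>2)"
          using L2_integrable[OF c_L2[of i l k]] ijl by simp
        show "R \<in> borel_measurable M" by (rule measurable_gen_M[OF R])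
        show "AE \<omega> in M. norm (R \<omega>) \<le> norm (1 + (cmod (c k i l \<omega>))\<^sup>2)"
        proof (rule AE_I2)
          fix \<omega> assume "\<omega> \<in> space M"
          hence "norm (R \<omega>) \<le> cmod (c k i l \<omega>)"
            using \<Gamma>_01[of i j \<omega> k] ijl u_unit by (auto simp: R_def norm_mult)
          also have "\<dots> \<le> 1 + (cmod (c k i l \<omega>))\<^sup>2"
            using zero_le_power2[of "cmod (c k i l \<omega>) - 1"] norm_ge_zero[of "c k i l \<omega>"]
            unfolding power2_diff power_one mult_1_right by linarith
          finally show "norm (R \<omega>) \<le> norm (1 + (cmod (c k i l \<omega>))\<^sup>2)" by simp
        qed
      qed
      hence "expectation (\<lambda>\<omega>. Re (h i j k \<omega> * R \<omega>)) = 0"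
        using ijl by (intro expectation_Re_mult_eq_0[of "{Chan i j k}" ?T] h_gen R h) auto
      moreover have "c k i j \<omega> * cnj (c k i l \<omega>) = h i j k \<omega> * R \<omega>" for \<omega>
        unfolding R_def using ijl True by (simp add: c_def[of k i j] mult_ac)
      ultimately show ?thesis by simp
    qed (use ijl in \<open>simp add: c_def\<close>)
    show ?thesis
    proof (cases "j = i")
      case True
      have "Re (c k i j \<omega> * cnj (c k i l \<omega>)) = Re (c k i l \<omega> * cnj (c k i j \<omega>))" for \<omega> by simp
      thus ?thesis using *[of l j] that True by (simp add: mult.commute)
    qed (use *[of j l] that in auto)
  qed

  \<comment> \<open>The protocol as drift plus noise\<close>
  have s_sq: "(s k i j \<omega>)\<^sup>2 = (if j = i then 1 else \<rho> * \<bar>x k j \<omega>\<bar>)" for k i j \<omega>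
    using rho_pos by (simp add: s_def power2_eq_square abs_mult)
  \<comment> \<open>The diagonal index adds \<open>n i k\<close> to the signal and
    \<open>\<sigma>2 i\<close> to its conditional mean power, matching the subtraction of
    \<open>\<sigma>2 i\<close> in the protocol. The other indices produce exactly the weights
    \<open>a i j\<close> applied to \<open>\<bar>x k j\<bar>\<close>.\<close>
  have step: "x (Suc k) i \<omega> = x k i \<omega> + \<alpha> k * (drift N a (\<lambda>j. x k j \<omega>) i + D k i \<omega>)"
    if i: "i < N" for k i \<omega>
  proof -
    have nE: "\<not> E i i" using E(3) by blast
    have "(\<Sum>j<N. c k i j \<omega> * complex_of_real (s k i j \<omega>))
      = n i k \<omega> + (\<Sum>j\<in>{..<N} - {i}. c k i j \<omega> * complex_of_real (s k i j \<omega>))"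
      using i by (subst sum.remove[of _ i]) (auto simp: c_def s_def)
    also have "(\<Sum>j\<in>{..<N} - {i}. c k i j \<omega> * complex_of_real (s k i j \<omega>))
      = (\<Sum>j\<in>{j. j < N \<and> E i j}. complex_of_real (\<Gamma> k i j \<omega>) * h i j k \<omega> * complex_of_real (sqrt (\<rho> * x k j \<omega>)) * u)"
      by (rule sum.mono_neutral_cong_right) (use nE in \<open>auto simp: c_def s_def\<close>)
    finally have 1: "(\<Sum>j<N. c k i j \<omega> * complex_of_real (s k i j \<omega>))
      = (\<Sum>j\<in>{j. j < N \<and> E i j}. complex_of_real (\<Gamma> k i j \<omega>) * h i j k \<omega> * complex_of_real (sqrt (\<rho> * x k j \<omega>)) * u) + n i k \<omega>"
      by simp
    have "(\<Sum>j<N. m i j * (s k i j \<omega>)\<^sup>2) = \<sigma>2 i + (\<Sum>j\<in>{..<N} - {i}. m i j * (s k i j \<omega>)\<^sup>2)"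
      using i by (subst sum.remove[of _ i]) (auto simp: m_def s_def)
    also have "(\<Sum>j\<in>{..<N} - {i}. m i j * (s k i j \<omega>)\<^sup>2) = (\<Sum>j<N. a i j * \<bar>x k j \<omega>\<bar>)"
      by (rule sum.mono_neutral_cong_left) (use nE in \<open>auto simp: m_def s_sq a_def abar_def q_def\<close>)
    finally have 2: "(\<Sum>j<N. m i j * (s k i j \<omega>)\<^sup>2) = \<sigma>2 i + (\<Sum>j<N. a i j * \<bar>x k j \<omega>\<bar>)" .
    have 3: "drift N a (\<lambda>j. x k j \<omega>) i = (\<Sum>j<N. a i j * \<bar>x k j \<omega>\<bar>) - (\<Sum>j<N. a i j) * x k i \<omega>"
      by (simp add: drift_def right_diff_distrib sum_subtractf sum_distrib_right)
    show ?thesis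
      unfolding x_step[OF i, folded a_def \<Gamma>_def] D_def 1 2 3 by (simp add: algebra_simps)
  qed

  \<comment> \<open>Adaptedness and square integrability of the states\<close>
  have now_past: "now k \<inter> past k = {}" for k by (auto simp: now_def past_def)
  have c_now: "c k i j \<in> borel_measurable (gen (now k))" for k i j
    by (rule c_gen) (auto simp: now_def)
  have s_past: "s k i j \<in> borel_measurable (gen (past k))"
    if x: "x k j \<in> borel_measurable (gen (past k))" for k i j
  proof -
    note [measurable] = x
    show ?thesis unfolding s_def[abs_def] by measurable
  qed
  have s_L2: "L2 M (\<lambda>\<omega>. (s k i j \<omega>)\<^sup>2)" if "L2 M (x k j)" for k i j
    unfolding s_sq using that by (cases "j = i") (auto intro: L2_const L2_cmult L2_abs)
  \<comment> \<open>Both properties go through one induction, because square integrability of the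
    noise at time \<open>k\<close> already requires the states at time \<open>k\<close> to be
    functions of the past.\<close>
  have x_past_L2: "\<forall>i<N. x k i \<in> borel_measurable (gen (past k)) \<and> L2 M (x k i)" for k
  proof (induction k)
    case 0
    have "x 0 i = (\<lambda>\<omega>. x0 i)" if "i < N" for i using x_init[OF that] by (rule ext)
    thus ?case by (auto intro: L2_const)
  next
    case (Suc k)
    hence x: "\<And>j. j < N \<Longrightarrow> x k j \<in> borel_measurable (gen (past k))" "\<And>j. j < N \<Longrightarrow> L2 M (x k j)" by auto
    have sub: "past k \<subseteq> past (Suc k)" "now k \<subseteq> past (Suc k)" by (auto simp: past_def now_def)
    show ?case
    proof (intro allI impI conjI)
      fix i assume i: "i < N"
      have x_eq: "x (Suc k) i = (\<lambda>\<omega>. x k i \<omega> + \<alpha> k * (drift N a (\<lambda>j. x k j \<omega>) i + D k i \<omega>))"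
        by (rule ext) (rule step[OF i])
      have [measurable]: "x k j \<in> borel_measurable (gen (past (Suc k)))"
        "s k i j \<in> borel_measurable (gen (past (Suc k)))" if "j < N" for j
        using measurable_gen_mono[OF sub(1)] x(1)[OF that] s_past[OF x(1)[OF that]] by blast+
      have [measurable]: "c k i j \<in> borel_measurable (gen (past (Suc k)))" for j
        using measurable_gen_mono[OF sub(2)] c_now by blast
      have "(\<lambda>\<omega>. drift N a (\<lambda>j. x k j \<omega>) i) \<in> borel_measurable (gen (past (Suc k)))"
        unfolding drift_def using i by (intro borel_measurable_sum) measurable
      moreover have "D k i \<in> borel_measurable (gen (past (Suc k)))"
      proof -
        have "(\<lambda>\<omega>. \<Sum>j<N. c k i j \<omega> * complex_of_real (s k i j \<omega>)) \<in> borel_measurable (gen (past (Suc k)))"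
          "(\<lambda>\<omega>. \<Sum>j<N. m i j * (s k i j \<omega>)\<^sup>2) \<in> borel_measurable (gen (past (Suc k)))"
          by (intro borel_measurable_sum; measurable)+
        thus ?thesis unfolding D_def[abs_def] by measurable
      qed
      ultimately show "x (Suc k) i \<in> borel_measurable (gen (past (Suc k)))"
        unfolding x_eq using i by measurable
      have "L2 M (D k i)" unfolding D_def[abs_def]
        by (rule quadratic_noise(1)[OF now_past[of k], where B = B])
          (assumption | rule i x c_now c_L2 c_2 c_4 c_uncorr s_past s_L2)+
      thus "L2 M (x (Suc k) i)"
        unfolding x_eq using i x(2) by (intro L2_add L2_cmult L2_drift) auto
    qed
  qed
  have x_L2: "L2 M (x k i)" and x_past: "x k i \<in> borel_measurable (gen (past k))" if "i < N" for k i
    using x_past_L2 that by auto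

  \<comment> \<open>Second moment of the noise\<close>
  define K where "K = real N ^ 4 * B * (real N + \<rho>\<^sup>2)"
  have noise: "L2 M (D k i)" "\<And>z. z \<in> borel_measurable (gen (past k)) \<Longrightarrow> L2 M z \<Longrightarrow> expectation (\<lambda>\<omega>. z \<omega> * D k i \<omega>) = 0"
    "expectation (\<lambda>\<omega>. (D k i \<omega>)\<^sup>2) \<le> real N ^ 4 * B * (\<Sum>j<N. expectation (\<lambda>\<omega>. ((s k i j \<omega>)\<^sup>2)\<^sup>2))"
    if i: "i < N" for k i
    unfolding D_def[abs_def]
    by (rule quadratic_noise[OF now_past[of k]];
        (assumption | rule i c_now c_L2 c_2 c_4 c_uncorr s_past s_L2 x_past x_L2)+)+
  have B0: "0 \<le> B" unfolding B_def by (intro add_nonneg_nonneg sum_nonneg) auto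
  have D_le: "expectation (\<lambda>\<omega>. (D k i \<omega>)\<^sup>2) \<le> K * (1 + (\<Sum>j<N. expectation (\<lambda>\<omega>. (x k j \<omega>)\<^sup>2)))"
    if i: "i < N" for k i
  proof -
    define S where "S = (\<Sum>j<N. expectation (\<lambda>\<omega>. (x k j \<omega>)\<^sup>2))"
    have S0: "0 \<le> S" unfolding S_def by (intro sum_nonneg) auto
    \<comment> \<open>The fourth power of \<open>s\<close> is 1 on the diagonal and \<rho>^2 x_j^2
      elsewhere. Bounding every index by the sum of both gives N + \<rho>^2 S \<le> (N + \<rho>^2)
      (1 + S), the origin of \<open>K\<close>.\<close>
    have "(\<Sum>j<N. expectation (\<lambda>\<omega>. ((s k i j \<omega>)\<^sup>2)\<^sup>2)) \<le> (\<Sum>j<N. 1 + \<rho>\<^sup>2 * expectation (\<lambda>\<omega>. (x k j \<omega>)\<^sup>2))"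
    proof (rule sum_mono)
      fix j
      show "expectation (\<lambda>\<omega>. ((s k i j \<omega>)\<^sup>2)\<^sup>2) \<le> 1 + \<rho>\<^sup>2 * expectation (\<lambda>\<omega>. (x k j \<omega>)\<^sup>2)"
        by (cases "j = i") (auto simp: s_sq power_mult_distrib prob_space)
    qed
    also have "\<dots> = real N + \<rho>\<^sup>2 * S" by (simp add: sum.distrib S_def sum_distrib_left)
    also have "\<dots> \<le> (real N + \<rho>\<^sup>2) * (1 + S)" using S0 by (simp add: algebra_simps)
    finally have "real N ^ 4 * B * (\<Sum>j<N. expectation (\<lambda>\<omega>. ((s k i j \<omega>)\<^sup>2)\<^sup>2))
       \<le> real N ^ 4 * B * ((real N + \<rho>\<^sup>2) * (1 + S))"
      using B0 by (intro mult_left_mono) auto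
    with noise(3)[OF i, of k] show ?thesis by (simp add: K_def S_def mult_ac)
  qed

  \<comment> \<open>Symmetry and positivity of the expected weights\<close>
  have q_pos: "0 < q i j" if "i < N" "j < N" for i j
    using p_range[OF that(1)] p_range[OF that(2)] unfolding q_def by (intro add_pos_pos mult_pos_pos) auto
  have a_E: "a i j = (if E i j then \<rho> * q i j * \<Lambda> i j else 0)" for i j
    by (simp add: a_def abar_def q_def)
  have a_pos: "0 < a i j" if "E i j" for i j
    using that E[OF that] q_pos Lambda_pos rho_pos by (simp add: a_E)
  have weights: "sym_weights N a"
  proof
    fix i j assume "i < N" "j < N"
    thus "a i j = a j i" using E(4)[of i j] E(4)[of j i] Lambda_sym[of i j]
      by (auto simp: a_E q_def)
    show "0 \<le> a i j" using a_pos[of i j] by (cases "E i j") (auto simp: a_E)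
  qed

  \<comment> \<open>Convergence of the expected disagreement\<close>
  let ?y = "\<lambda>k i \<omega>. x k i \<omega> - (\<Sum>j<N. x k j \<omega>) / real N"
  have y: "integrable M (\<lambda>\<omega>. (?y k i \<omega>)\<^sup>2)" if "i < N" for k i
    using L2_cmult[OF L2_sum[of "{..<N}" M "x k"], of "1 / real N"] that
    by (intro L2_square L2_diff) (auto simp: x_L2)
  have int: "integrable M (\<lambda>\<omega>. \<Sum>i<N. (?y k i \<omega>)\<^sup>2)" for k
    by (intro Bochner_Integration.integrable_sum y) auto
  have lim: "(\<lambda>k. expectation (\<lambda>\<omega>. \<Sum>i<N. (?y k i \<omega>)\<^sup>2)) \<longlonglongrightarrow> 0"
  proof (rule mean_square_consensus[OF weights, where E = E and K = K and D = D and \<alpha> = \<alpha>])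
    show "E\<^sup>*\<^sup>* i j" if "i < N" "j < N" for i j using conn that by (simp add: connected_graph_def)
    show "0 \<le> K" unfolding K_def using B0 by simp
  qed (use E a_pos x_L2 noise x_past step D_le alpha_sum alpha_sq_sum in \<open>auto intro: less_imp_le alpha_pos\<close>)
  have "(\<lambda>k. expectation (\<lambda>\<omega>. (?y k i \<omega>)\<^sup>2)) \<longlonglongrightarrow> 0" if i: "i < N" for i
  proof (rule tendsto_sandwich[OF _ _ tendsto_const lim])
    show "\<forall>\<^sub>F k in sequentially. expectation (\<lambda>\<omega>. (?y k i \<omega>)\<^sup>2) \<le> expectation (\<lambda>\<omega>. \<Sum>i<N. (?y k i \<omega>)\<^sup>2)"
    proof (intro always_eventually allI integral_mono y int i)
      show "(?y k i \<omega>)\<^sup>2 \<le> (\<Sum>i<N. (?y k i \<omega>)\<^sup>2)" for k \<omega>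
        by (rule member_le_sum) (use i in auto)
    qed
  qed (auto intro!: always_eventually Bochner_Integration.integral_nonneg)
  with int lim show ?thesis by blast
qed

end
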